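(* Let $\Gamma$ be a unicyclic signed graph of order $n\ge 4$. Then $\eta(\Gamma)=n-4$ if and only if $\Gamma$ is one of the following unicyclic signed graphs of order $n$: - the unbalanced cycle $C_4$; - the unbalanced cycle $C_6$; - a signed graph (with arbitrary signs) whose underlying graph is $U_1(r,s)$ or $U_2(r,s)$ for some integers $r\ge s\ge 0$ with $r+s\ge 1$; - a balanced signed graph whose underlying graph is $U_3(r)$ for some integer $r\ge 1$.
   Context: A signed graph $\Gamma=(G,\sigma)$ consists of a finite simple graph $G=(V,E)$ (its underlying graph) and a map $\sigma:E\to\{+,-\}$. Its adjacency matrix is $A(\Gamma)=(a_{ij}^\sigma)$ with $a_{ij}^\sigma=\sigma(v_iv_j)a_{ij}$ (i.e. $\pm1$ according to the sign of the edge $v_iv_j$, and $0$ if $v_i,v_j$ are not adjacent), where $(a_{ij})$ is the adjacency matrix of $G$. The nullity $\eta(\Gamma)$ is the multiplicity of the eigenvalue $0$ of $A(\Gamma)$. The order is the number of vertices. The sign of a cycle $C$ is $\prod_{e\in C}\sigma(e)$; a cycle is positive or negative according to its sign. A signed graph is balanced if all its cycles are positive, and unbalanced otherwise. A signed graph is unicyclic if its underlying graph is connected and contains exactly one cycle. $C_m$ denotes the cycle of order $m$, and $K_{1,m}$ the star with $m$ edges (order $m+1$). The graphs $U_i$: for integers $r\ge s\ge 0$ with $r+s\ge1$, $U_1(r,s)$ is obtained from a triangle by attaching $r$ pendant edges at one vertex and $s$ pendant edges at another vertex; $U_2(r,s)$ is obtained from a square (the cycle $C_4$) by attaching $r$ pendant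 edges at one vertex and $s$ pendant edges at the vertex not adjacent to it. For an integer $r\ge1$, $U_3(r)$ is obtained from a square by identifying one vertex of the square with a pendant (degree-one) vertex of a star $K_{1,r+1}$. *)

theory Defs
  imports "Jordan_Normal_Form.Char_Poly"
begin

section \<open>Finite simple graphs and signed graphs\<close>

type_synonym 'a ugraph = "'a set \<times> 'a set set"

abbreviation verts :: "'a ugraph \<Rightarrow> 'a set" where "verts \<equiv> fst"
abbreviation edges :: "'a ugraph \<Rightarrow> 'a set set" where "edges \<equiv> snd"

definition simple_graph :: "'a ugraph \<Rightarrow> bool" where
  "simple_graph G \<longleftrightarrow> finite (verts G) \<and> (\<forall>e\<in>edges G. e \<subseteq> verts G \<and> card e = 2)"

text \<open>The signs $+$ and $-$ are the reals $1$ and $-1$; the values of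
  \<open>\<sigma>\<close> outside the edge set are irrelevant.\<close>

definition signed_graph :: "'a ugraph \<Rightarrow> ('a set \<Rightarrow> real) \<Rightarrow> bool" where
  "signed_graph G \<sigma> \<longleftrightarrow> simple_graph G \<and> (\<forall>e\<in>edges G. \<sigma> e \<in> {1, -1})"

definition graph_iso :: "'a ugraph \<Rightarrow> 'b ugraph \<Rightarrow> bool" where
  "graph_iso G H \<longleftrightarrow>
     (\<exists>f. bij_betw f (verts G) (verts H) \<and>
          (\<forall>u\<in>verts G. \<forall>v\<in>verts G. {u, v} \<in> edges G \<longleftrightarrow> {f u, f v} \<in> edges H))"

definition connected_graph :: "'a ugraph \<Rightarrow> bool" where
  "connected_graph G \<longleftrightarrow>
     verts G \<noteq> {} \<and>
     (\<forall>u\<in>verts G. \<forall>v\<in>verts G. (u, v) \<in> {(x, y). {x, y} \<in> edges G}\<^sup>*)"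

text \<open>A cycle is a subgraph without isolated vertices, so it is represented by its edge set.
  In particular, vertex sequences that differ by rotation or reversal give the same cycle.\<close>

definition cycle_edges :: "'a list \<Rightarrow> 'a set set" where
  "cycle_edges vs = {{vs ! i, vs ! (Suc i mod length vs)} | i. i < length vs}"

definition is_cycle :: "'a ugraph \<Rightarrow> 'a set set \<Rightarrow> bool" where
  "is_cycle G C \<longleftrightarrow>
     C \<subseteq> edges G \<and> (\<exists>vs. 3 \<le> length vs \<and> distinct vs \<and> C = cycle_edges vs)"

definition unicyclic :: "'a ugraph \<Rightarrow> bool" where
  "unicyclic G \<longleftrightarrow> connected_graph G \<and> (\<exists>!C. is_cycle G C)"

definition balanced :: "'a ugraph \<Rightarrow> ('a set \<Rightarrow> real) \<Rightarrow> bool" where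
  "balanced G \<sigma> \<longleftrightarrow> (\<forall>C. is_cycle G C \<longrightarrow> (\<Prod>e\<in>C. \<sigma> e) = 1)"


section \<open>Adjacency matrix and nullity\<close>

definition adj :: "'a ugraph \<Rightarrow> 'a \<Rightarrow> 'a \<Rightarrow> real" where
  "adj G u v = (if {u, v} \<in> edges G then 1 else 0)"

definition signed_adj_mat :: "'a ugraph \<Rightarrow> ('a set \<Rightarrow> real) \<Rightarrow> 'a list \<Rightarrow> real mat" where
  "signed_adj_mat G \<sigma> vs =
     mat (length vs) (length vs) (\<lambda>(i, j). \<sigma> {vs ! i, vs ! j} * adj G (vs ! i) (vs ! j))"

text \<open>The multiplicity of the eigenvalue $0$ is its multiplicity as a root of the characteristic
  polynomial. The choice of the enumeration of the vertices is immaterial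
  (lemma \<open>nullity_eq\<close>).\<close>

definition nullity :: "'a ugraph \<Rightarrow> ('a set \<Rightarrow> real) \<Rightarrow> nat" where
  "nullity G \<sigma> =
     Polynomial.order 0
       (char_poly (signed_adj_mat G \<sigma> (SOME vs. distinct vs \<and> set vs = verts G)))"

lemma char_poly_signed_adj_mat_cong:
  assumes "distinct vs" "distinct ws" "set vs = set ws"
  shows "char_poly (signed_adj_mat G \<sigma> vs) = char_poly (signed_adj_mat G \<sigma> ws)"
proof -
  define n where "n = length vs"
  have len: "length vs = n" "length ws = n"
    using distinct_card[of vs] distinct_card[of ws] assms by (auto simp: n_def)
  define a where "a u v = \<sigma> {u, v} * adj G u v" for u v
  define P where "P xs ys = mat n n (\<lambda>(i, j). if xs ! i = ys ! j then 1 else 0 :: real)"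
    for xs ys :: "'a list"
  let ?A = "signed_adj_mat G \<sigma>"
  have A: "?A xs = mat n n (\<lambda>(i, j). a (xs ! i) (xs ! j))" if "length xs = n" for xs
    using that by (simp add: signed_adj_mat_def a_def)
  have sum_left: "(\<Sum>k<n. f (ys ! k) * (if xs ! i = ys ! k then 1 else 0)) = f (xs ! i)"
    if "i < n" "set xs = set ys" "distinct ys" "length xs = n" "length ys = n"
    for f :: "'a \<Rightarrow> real" and i xs ys
  proof -
    have "xs ! i \<in> set ys" using that nth_mem[of i xs] by simp
    then obtain k0 where k0: "k0 < n" "xs ! i = ys ! k0"
      using \<open>length ys = n\<close> unfolding in_set_conv_nth by auto
    have "(\<Sum>k<n. f (ys ! k) * (if xs ! i = ys ! k then 1 else 0)) =
          (\<Sum>k<n. if k = k0 then f (xs ! i) else 0)"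
      using that k0 by (intro sum.cong) (auto simp: nth_eq_iff_index_eq)
    also have "\<dots> = f (xs ! i)" using k0 by simp
    finally show ?thesis .
  qed
  have PP: "P xs ys * P ys xs = 1\<^sub>m n"
    if "set xs = set ys" "distinct xs" "distinct ys" "length xs = n" "length ys = n" for xs ys
  proof (rule eq_matI)
    fix i j assume ij: "i < dim_row (1\<^sub>m n :: real mat)" "j < dim_col (1\<^sub>m n :: real mat)"
    have "(P xs ys * P ys xs) $$ (i, j) =
          (\<Sum>k<n. (if ys ! k = xs ! j then 1 else 0) * (if xs ! i = ys ! k then 1 else 0))"
      using ij by (simp add: P_def scalar_prod_def atLeast0LessThan mult.commute)
    also have "\<dots> = (if xs ! i = xs ! j then 1 else 0)"
      using sum_left[of i xs ys "\<lambda>y. if y = xs ! j then 1 else 0"] that ij by simp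
    also have "\<dots> = (1\<^sub>m n :: real mat) $$ (i, j)"
      using ij that by (auto simp: nth_eq_iff_index_eq)
    finally show "(P xs ys * P ys xs) $$ (i, j) = (1\<^sub>m n :: real mat) $$ (i, j)" .
  qed (auto simp: P_def)
  have [simp]: "P xs ys \<in> carrier_mat n n" for xs ys by (simp add: P_def)
  have car: "?A vs \<in> carrier_mat n n" "?A ws \<in> carrier_mat n n" using len by (auto simp: A)
  have comm: "?A vs * P vs ws = P vs ws * ?A ws"
  proof (rule eq_matI)
    fix i j assume "i < dim_row (P vs ws * ?A ws)" "j < dim_col (P vs ws * ?A ws)"
    then have ij: "i < n" "j < n" using len by (auto simp: P_def A)
    have "(?A vs * P vs ws) $$ (i, j) =
          (\<Sum>k<n. a (vs ! i) (vs ! k) * (if ws ! j = vs ! k then 1 else 0))"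
      using ij len
      by (simp add: A P_def scalar_prod_def atLeast0LessThan eq_commute[of "ws ! j"])
    also have "\<dots> = a (vs ! i) (ws ! j)"
      using sum_left[of j ws vs "\<lambda>y. a (vs ! i) y"] assms len ij by simp
    also have "\<dots> = (\<Sum>k<n. a (ws ! k) (ws ! j) * (if vs ! i = ws ! k then 1 else 0))"
      using sum_left[of i vs ws "\<lambda>y. a y (ws ! j)"] assms len ij by simp
    also have "\<dots> = (P vs ws * ?A ws) $$ (i, j)"
      using ij len by (simp add: A P_def scalar_prod_def atLeast0LessThan mult.commute)
    finally show "(?A vs * P vs ws) $$ (i, j) = (P vs ws * ?A ws) $$ (i, j)" .
  qed (use len in \<open>auto simp: P_def A\<close>)
  have "P vs ws * ?A ws * P ws vs = ?A vs * P vs ws * P ws vs" by (simp add: comm)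
  also have "\<dots> = ?A vs * (P vs ws * P ws vs)"
    by (rule assoc_mult_mat[of _ n n _ n _ n]) (use car in auto)
  also have "\<dots> = ?A vs" using PP[of vs ws] assms len car by simp
  finally have eq: "?A vs = P vs ws * ?A ws * P ws vs" ..
  have "dim_row (?A vs) = n" using car by auto
  then have "similar_mat_wit (?A vs) (?A ws) (P vs ws) (P ws vs)"
    unfolding similar_mat_wit_def Let_def
    using PP[of vs ws] PP[of ws vs] assms len car eq by auto
  then have "similar_mat (?A vs) (?A ws)" unfolding similar_mat_def by blast
  then show ?thesis by (rule char_poly_similar)
qed

lemma nullity_eq:
  assumes "distinct vs" "set vs = verts G"
  shows "nullity G \<sigma> = Polynomial.order 0 (char_poly (signed_adj_mat G \<sigma> vs))"
proof -
  let ?P = "\<lambda>ws. distinct ws \<and> set ws = verts G"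
  have "?P (SOME ws. ?P ws)" using assms by (intro someI[of ?P vs]) auto
  then show ?thesis
    unfolding nullity_def
    using assms char_poly_signed_adj_mat_cong[of "SOME ws. ?P ws" vs G \<sigma>] by simp
qed


section \<open>The graphs of the classification\<close>

definition cycle_graph :: "nat \<Rightarrow> nat ugraph" where
  "cycle_graph m = ({..<m}, cycle_edges [0..<m])"

definition star_edges :: "'a \<Rightarrow> 'a set \<Rightarrow> 'a set set" where
  "star_edges c L = {{c, l} | l. l \<in> L}"

text \<open>In \<open>U1\<close> and \<open>U2\<close> the pendant vertices follow the vertices of the cycle,
  first the $r$ pendant vertices at \<open>0\<close>, then the other $s$. The vertices \<open>0\<close> and
  \<open>2\<close> of \<open>cycle_graph 4\<close> are not adjacent.\<close>

definition U1 :: "nat \<Rightarrow> nat \<Rightarrow> nat ugraph" where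
  "U1 r s = ({..<3 + r + s},
     edges (cycle_graph 3) \<union> star_edges 0 {3..<3 + r} \<union> star_edges 1 {3 + r..<3 + r + s})"

definition U2 :: "nat \<Rightarrow> nat \<Rightarrow> nat ugraph" where
  "U2 r s = ({..<4 + r + s},
     edges (cycle_graph 4) \<union> star_edges 0 {4..<4 + r} \<union> star_edges 2 {4 + r..<4 + r + s})"

text \<open>The star $K_{1,r+1}$ in \<open>U3\<close> has centre \<open>4\<close>; its leaf \<open>0\<close> is the identified vertex
  of the square, and its other leaves are \<open>5, \<dots>, 4 + r\<close>.\<close>

definition U3 :: "nat \<Rightarrow> nat ugraph" where
  "U3 r = ({..<5 + r}, edges (cycle_graph 4) \<union> star_edges 4 (insert 0 {5..<5 + r}))"

end

theory Submission
  imports Defs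
begin

text \<open>
  The rank of a real symmetric matrix is the largest size of a nonsingular principal submatrix, so
  the nullity of a signed graph of order \<open>n\<close> is \<open>n - k\<close>, where \<open>k\<close> is the largest size of a
  vertex set whose induced signed subgraph has a nonsingular adjacency matrix. Two forms of this
  carry the whole proof. A nonsingular set \<open>K\<close> bounds the nullity by \<open>n - card K\<close>
  (\<open>nullity_le_of_nonsingular\<close>), and the bound is attained if the rows of all other vertices are
  linear combinations of the rows of \<open>K\<close> (\<open>nullity_spanned\<close>). Nonsingularity is tested by the
  absence of nonzero solutions, so that no determinant of a graph has to be expanded.

  A graph is searched for nonsingular sets with one reduction: a vertex \<open>u\<close> whose only neighbour
  in the set is \<open>w\<close> may be removed together with \<open>w\<close> (\<open>nonsingular_on_insert_pair\<close>). Three such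
  removals in a row give a nonsingular set of size \<open>6\<close>, which is impossible if the nullity is
  \<open>n - 4\<close> (\<open>no_three_pairs\<close>). For a unicyclic graph of nullity \<open>n - 4\<close> this leaves little room.
  A cycle of length at least \<open>7\<close> contains an induced path on \<open>6\<close> vertices, and the pentagon is
  itself nonsingular. For the lengths \<open>3\<close>, \<open>4\<close> and \<open>6\<close>, the vertices outside the cycle can only
  be placed as in the listed graphs, or else three pairs appear, or a triangle or an unbalanced
  square together with a disjoint pair. The signs matter only where a whole square or hexagon is
  tested: a square is nonsingular iff it is negative, a hexagon iff it is positive.

  Conversely, each listed graph contains an explicit nonsingular set of four vertices whose rows
  span all the others.

  Uniqueness of the cycle enters in a single form: all vertex sequences of cycles have the same
  vertices and the same length (\<open>cycle_list_unique\<close>). Every adjacency that has to be excluded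
  would close a cycle that is too short or that leaves the vertex set of the given one.
\<close>

section \<open>The multiplicity of the eigenvalue zero\<close>

text \<open>
  Subtracting \<open>L\<close> times the upper block row makes the lower one zero. Completed to a similarity,
  this step adds \<open>B * L\<close> to the upper left block, and the result is block triangular with the
  diagonal blocks \<open>A + B * L\<close> and \<open>0\<close>.
\<close>

lemma order_char_poly_row_extension:
  fixes A :: "real mat"
  assumes A: "A \<in> carrier_mat k k" and B: "B \<in> carrier_mat k m" and L: "L \<in> carrier_mat m k"
    and det: "det (A + B * L) \<noteq> 0"
  shows "Polynomial.order 0 (char_poly (four_block_mat A B (L * A) (L * B))) = m"
proof -
  let ?X = "A + B * L"
  let ?T = "four_block_mat ?X B (0\<^sub>m m k) (0\<^sub>m m m)"
  let ?P = "four_block_mat (1\<^sub>m k) (0\<^sub>m k m) L (1\<^sub>m m)"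
  let ?Q = "four_block_mat (1\<^sub>m k) (0\<^sub>m k m) (- L) (1\<^sub>m m)"
  let ?M = "four_block_mat A B (L * A) (L * B)"
  have X: "?X \<in> carrier_mat k k" and LA: "L * A \<in> carrier_mat m k" and LB: "L * B \<in> carrier_mat m m"
    and BL: "B * L \<in> carrier_mat k k" and mL: "- L \<in> carrier_mat m k"
    using A B L by auto
  have z1: "1\<^sub>m k + - 0\<^sub>m k k = (1\<^sub>m k :: real mat)" and z2: "L + - L = 0\<^sub>m m k"
    using L by auto
  have PQ: "?P * ?Q = 1\<^sub>m (k + m)"
    by (subst mult_four_block_mat[of _ k k _ m _ m]) (use L z1 z2 in auto)
  have QP: "?Q * ?P = 1\<^sub>m (k + m)"
    by (subst mult_four_block_mat[of _ k k _ m _ m]) (use L in auto)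
  have PT: "?P * ?T = four_block_mat ?X B (L * ?X) (L * B)"
    by (subst mult_four_block_mat[of _ k k _ m _ m]) (use A B L X in auto)
  have e1: "?X + B * (- L) = A"
  proof -
    have "?X + B * (- L) = A + B * L - B * L"
      using A B L by (simp add: add_uminus_minus_mat[of _ k k])
    also have "\<dots> = A" using A B L by auto
    finally show ?thesis .
  qed
  have e2: "L * ?X + L * B * (- L) = L * A"
  proof -
    have "L * ?X + L * B * (- L) = L * ?X + L * (B * (- L))"
      using assoc_mult_mat[OF L B mL] by simp
    also have "\<dots> = L * (?X + B * (- L))"
      using mult_add_distrib_mat[OF L X, of "B * (- L)"] B mL by simp
    finally show ?thesis by (simp add: e1)
  qed
  have LX: "L * ?X \<in> carrier_mat m k" using L X by auto
  have PTQ: "?P * ?T * ?Q = ?M"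
    unfolding PT
    by (subst mult_four_block_mat[OF X B LX LB one_carrier_mat zero_carrier_mat mL one_carrier_mat])
      (use A B L X LX LB mL e1 e2 in auto)
  have "similar_mat_wit ?M ?T ?P ?Q"
    by (rule similar_mat_witI[OF PQ QP PTQ[symmetric]]) (use A B L X LA LB mL in auto)
  then have "char_poly ?M = char_poly ?T"
    by (intro char_poly_similar) (auto simp: similar_mat_def)
  also have "\<dots> = char_poly ?X * [:0, 1:] ^ m"
  proof -
    have "char_poly_matrix ?T = four_block_mat (char_poly_matrix ?X) (map_mat (\<lambda>a. [:- a:]) B)
        (0\<^sub>m m k) ([:0, 1:] \<cdot>\<^sub>m 1\<^sub>m m)"
      by (rule eq_matI) (use A B L in \<open>auto simp: char_poly_matrix_def\<close>)
    then have "char_poly ?T = det (char_poly_matrix ?X) * det ([:0, 1:] \<cdot>\<^sub>m 1\<^sub>m m)"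
      unfolding char_poly_def
      by (simp add: det_four_block_mat_lower_left_zero[of _ k _ m] X B)
    then show ?thesis by (simp add: char_poly_def det_smult)
  qed
  finally have cp: "char_poly ?M = char_poly ?X * [:0, 1:] ^ m" .
  have "poly (char_poly ?X) 0 \<noteq> 0"
  proof -
    have "char_matrix Y 0 = Y" if "Y \<in> carrier_mat k k" for Y :: "real mat"
      using that by (auto simp: char_matrix_def intro!: eq_matI)
    from this[OF X] have "poly (char_poly ?X) 0 = det (- ?X)" using char_poly_matrix[OF X, of 0] by simp
    then show ?thesis using det det_0_negate[OF X] by simp
  qed
  then have "Polynomial.order 0 (char_poly ?X) = 0" "char_poly ?X \<noteq> 0"
    by (auto simp: order_root)
  moreover have "Polynomial.order 0 ([:0, 1:] ^ m :: real poly) = m"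
    using order_power_n_n[of "0::real" m] by simp
  ultimately show ?thesis unfolding cp by (subst order_mult) auto
qed

text \<open>
  Nonsingularity of the principal submatrix with index set \<open>K\<close>, for a matrix given as a function
  of two vertices. The absence of nontrivial solutions needs no enumeration of \<open>K\<close>.
\<close>

definition nonsingular_on :: "('a \<Rightarrow> 'a \<Rightarrow> real) \<Rightarrow> 'a set \<Rightarrow> bool" where
  "nonsingular_on a K \<longleftrightarrow>
     (\<forall>x. (\<forall>u\<in>K. (\<Sum>v\<in>K. a u v * x v) = 0) \<longrightarrow> (\<forall>v\<in>K. x v = 0))"

lemma nonsingular_onI:
  assumes "\<And>x v. (\<And>u. u \<in> K \<Longrightarrow> (\<Sum>v\<in>K. a u v * x v) = 0) \<Longrightarrow> v \<in> K \<Longrightarrow> x v = 0"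
  shows "nonsingular_on a K"
  using assms unfolding nonsingular_on_def by blast

lemma nonsingular_onD:
  assumes "nonsingular_on a K" "\<And>u. u \<in> K \<Longrightarrow> (\<Sum>v\<in>K. a u v * x v) = 0" "v \<in> K"
  shows "x v = 0"
  using assms unfolding nonsingular_on_def by blast

lemma sum_nth_distinct:
  assumes "distinct xs"
  shows "(\<Sum>i = 0..<length xs. f (xs ! i)) = (\<Sum>u\<in>set xs. f u)"
  using sum.reindex_bij_betw[OF bij_betw_nth[OF assms refl refl], of f] by (simp add: atLeast0LessThan)

definition row_spanned :: "('a \<Rightarrow> 'a \<Rightarrow> real) \<Rightarrow> 'a set \<Rightarrow> 'a set \<Rightarrow> 'a \<Rightarrow> bool" where
  "row_spanned a V K v \<longleftrightarrow> (\<exists>c. \<forall>w\<in>V. a v w = (\<Sum>u\<in>K. c u * a u w))"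

text \<open>
  If \<open>C\<close> expresses all rows by those in \<open>K\<close> and \<open>A\<close> is the principal submatrix of \<open>K\<close>, then by
  symmetry the whole matrix is \<open>C A C\<^sup>T\<close>. The block \<open>A + B L\<close> of the previous lemma is
  \<open>A (C\<^sup>T C)\<close>: it is nonsingular because \<open>A\<close> is, by assumption, and \<open>C\<^sup>T C\<close> is positive definite.
\<close>

lemma order_char_poly_spanned:
  fixes a :: "'a \<Rightarrow> 'a \<Rightarrow> real"
  assumes sym: "\<And>u v. a u v = a v u"
    and dist: "distinct (ks @ ls)"
    and ns: "nonsingular_on a (set ks)"
    and span: "\<And>v. v \<in> set ls \<Longrightarrow> row_spanned a (set (ks @ ls)) (set ks) v"
  shows "Polynomial.order 0 (char_poly (mat (length (ks @ ls)) (length (ks @ ls))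
           (\<lambda>(i, j). a ((ks @ ls) ! i) ((ks @ ls) ! j)))) = length ls"
proof -
  define k m where "k = length ks" and "m = length ls"
  define K N V where "K = set ks" and "N = set ls" and "V = K \<union> N"
  have "\<exists>c. \<forall>v\<in>N. \<forall>w\<in>V. a v w = (\<Sum>u\<in>K. c v u * a u w)"
    using span unfolding row_spanned_def K_def N_def V_def set_append by metis
  then obtain c where c: "\<And>v w. v \<in> N \<Longrightarrow> w \<in> V \<Longrightarrow> a v w = (\<Sum>u\<in>K. c v u * a u w)"
    by blast
  have dks: "distinct ks" and dls: "distinct ls" and disj: "K \<inter> N = {}"
    using dist by (auto simp: K_def N_def)
  have fin: "finite K" "finite N" by (auto simp: K_def N_def)
  have inK: "ks ! i \<in> K" if "i < k" for i using that by (auto simp: K_def k_def)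
  have inN: "ls ! i \<in> N" if "i < m" for i using that by (auto simp: N_def m_def)
  have sumK: "(\<Sum>i = 0..<k. f (ks ! i)) = sum f K" for f :: "'a \<Rightarrow> real"
    using sum_nth_distinct[OF dks, of f] by (simp add: k_def K_def)
  have sumN: "(\<Sum>i = 0..<m. f (ls ! i)) = sum f N" for f :: "'a \<Rightarrow> real"
    using sum_nth_distinct[OF dls, of f] by (simp add: m_def N_def)
  define A where "A = mat k k (\<lambda>(i, j). a (ks ! i) (ks ! j))"
  define B where "B = mat k m (\<lambda>(i, j). a (ks ! i) (ls ! j))"
  define L where "L = mat m k (\<lambda>(i, j). c (ls ! i) (ks ! j))"
  have car: "A \<in> carrier_mat k k" "B \<in> carrier_mat k m" "L \<in> carrier_mat m k"
    by (auto simp: A_def B_def L_def)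
  have X: "A + B * L \<in> carrier_mat k k" using car by auto
  have block: "mat (length (ks @ ls)) (length (ks @ ls)) (\<lambda>(i, j). a ((ks @ ls) ! i) ((ks @ ls) ! j))
      = four_block_mat A B (L * A) (L * B)" (is "?M = ?R")
  proof (rule eq_matI)
    fix i j assume "i < dim_row ?R" "j < dim_col ?R"
    then have ij: "i < k + m" "j < k + m" using car by auto
    have LA: "(L * A) $$ (i - k, j) = a (ls ! (i - k)) (ks ! j)" if "\<not> i < k" "j < k"
      using that ij inK[of j] inN[of "i - k"]
      by (simp add: L_def A_def scalar_prod_def sumK[of "\<lambda>u. c _ u * a u _"] c V_def)
    have LB: "(L * B) $$ (i - k, j - k) = a (ls ! (i - k)) (ls ! (j - k))" if "\<not> i < k" "\<not> j < k"
      using that ij inN[of "j - k"] inN[of "i - k"]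
      by (simp add: L_def B_def scalar_prod_def sumK[of "\<lambda>u. c _ u * a u _"] c V_def)
    show "?M $$ (i, j) = ?R $$ (i, j)"
      using ij car LA LB by (auto simp: k_def[symmetric] m_def[symmetric] nth_append) (auto simp: A_def B_def)
  qed (use car in \<open>auto simp: k_def m_def\<close>)
  have "det (A + B * L) \<noteq> 0"
  proof
    assume "det (A + B * L) = 0"
    then obtain z where z: "z \<in> carrier_vec k" "z \<noteq> 0\<^sub>v k" "(A + B * L) *\<^sub>v z = 0\<^sub>v k"
      using det_0_iff_vec_prod_zero_field[OF X] by blast
    define x where "x u = (if u \<in> K then z $ (THE i. i < k \<and> ks ! i = u) else 0)" for u
    have x: "x (ks ! i) = z $ i" if "i < k" for i
    proof -
      have "(THE i'. i' < k \<and> ks ! i' = ks ! i) = i"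
        using that dks by (intro the_equality) (auto simp: k_def nth_eq_iff_index_eq)
      then show ?thesis using that inK by (simp add: x_def)
    qed
    \<comment> \<open>In matrix notation, \<open>y\<close> is \<open>C x\<close>, and \<open>t\<close> below is \<open>C\<^sup>T y\<close> on \<open>K\<close>.\<close>
    define y where "y w = (if w \<in> K then x w else (\<Sum>u\<in>K. c w u * x u))" for w
    have Ly: "(L *\<^sub>v z) $ i = y (ls ! i)" if "i < m" for i
      using that inN[OF that] disj z(1)
        sumK[of "\<lambda>u. c (ls ! i) u * x u"] x
      by (auto simp: L_def scalar_prod_def y_def)
    have ay: "(\<Sum>w\<in>V. a u w * y w) = 0" if u: "u \<in> K" for u
    proof -
      obtain i where i: "i < k" "u = ks ! i" using u by (auto simp: K_def k_def in_set_conv_nth)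
      have "0 = ((A + B * L) *\<^sub>v z) $ i" using z i by simp
      also have "(A + B * L) *\<^sub>v z = A *\<^sub>v z + B *\<^sub>v (L *\<^sub>v z)"
        using car z(1) by (simp add: add_mult_distrib_mat_vec[of _ k k])
      also have "\<dots> $ i = (A *\<^sub>v z) $ i + (B *\<^sub>v (L *\<^sub>v z)) $ i"
        using car i by simp
      also have "(A *\<^sub>v z) $ i = (\<Sum>w\<in>K. a u w * x w)"
        using sumK[of "\<lambda>w. a u w * x w"] x i z(1) by (simp add: A_def scalar_prod_def)
      also have "\<dots> = (\<Sum>w\<in>K. a u w * y w)" by (intro sum.cong) (auto simp: y_def)
      also have "(B *\<^sub>v (L *\<^sub>v z)) $ i = (\<Sum>w\<in>N. a u w * y w)"
      proof -
        have "(B *\<^sub>v (L *\<^sub>v z)) $ i = (\<Sum>j = 0..<m. a u (ls ! j) * (L *\<^sub>v z) $ j)"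
          using i car by (simp add: B_def scalar_prod_def)
        also have "\<dots> = (\<Sum>j = 0..<m. a u (ls ! j) * y (ls ! j))"
          using Ly by (intro sum.cong) auto
        finally show ?thesis using sumN[of "\<lambda>w. a u w * y w"] by simp
      qed
      finally show ?thesis using disj fin by (simp add: V_def sum.union_disjoint)
    qed
    define t where "t u = y u + (\<Sum>w\<in>N. c w u * y w)" for u
    have At: "(\<Sum>u'\<in>K. a u u' * t u') = 0" if u: "u \<in> K" for u
    proof -
      have "(\<Sum>w\<in>N. a u w * y w) = (\<Sum>w\<in>N. \<Sum>u'\<in>K. c w u' * a u u' * y w)"
        using c u sym by (intro sum.cong) (auto simp: sum_distrib_right V_def)
      also have "\<dots> = (\<Sum>u'\<in>K. a u u' * (\<Sum>w\<in>N. c w u' * y w))"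
        by (subst sum.swap) (simp add: sum_distrib_left algebra_simps)
      finally show ?thesis using ay[OF u] disj fin
        by (simp add: V_def sum.union_disjoint t_def algebra_simps sum.distrib)
    qed
    have t0: "t u = 0" if "u \<in> K" for u
      using nonsingular_onD[OF ns, of t u] At that by (auto simp: K_def)
    \<comment> \<open>The inner product of \<open>x\<close> with \<open>C\<^sup>T C x = 0\<close> is the squared norm of \<open>C x\<close>.\<close>
    have "0 = (\<Sum>u\<in>K. x u * t u)" using t0 by simp
    also have "\<dots> = (\<Sum>u\<in>K. y u * y u) + (\<Sum>u\<in>K. \<Sum>w\<in>N. c w u * x u * y w)"
      by (simp add: t_def y_def algebra_simps sum.distrib sum_distrib_left)
    also have "(\<Sum>u\<in>K. \<Sum>w\<in>N. c w u * x u * y w) = (\<Sum>w\<in>N. y w * y w)"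
      using disj by (subst sum.swap) (auto simp: y_def sum_distrib_right intro!: sum.cong)
    finally have "(\<Sum>u\<in>K. y u * y u) + (\<Sum>w\<in>N. y w * y w) = 0" by simp
    moreover have "(\<Sum>w\<in>N. y w * y w) \<ge> 0" "(\<Sum>u\<in>K. y u * y u) \<ge> 0" by (auto intro!: sum_nonneg)
    ultimately have "(\<Sum>u\<in>K. y u * y u) = 0" by linarith
    then have "\<forall>u\<in>K. y u = 0" using fin by (simp add: sum_nonneg_eq_0_iff)
    then have "z = 0\<^sub>v k" using z(1) x inK by (intro eq_vecI) (force simp: y_def)+
    then show False using z by simp
  qed
  then show ?thesis unfolding block using order_char_poly_row_extension[OF car] by (simp add: m_def)
qed

definition signed_adj :: "'a ugraph \<Rightarrow> ('a set \<Rightarrow> real) \<Rightarrow> 'a \<Rightarrow> 'a \<Rightarrow> real" where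
  "signed_adj G \<sigma> u v = \<sigma> {u, v} * adj G u v"

lemma signed_adj_commute: "signed_adj G \<sigma> u v = signed_adj G \<sigma> v u"
  by (simp add: signed_adj_def adj_def insert_commute)

lemma nullity_spanned:
  assumes fin: "finite (verts G)" and KV: "K \<subseteq> verts G"
    and ns: "nonsingular_on (signed_adj G \<sigma>) K"
    and span: "\<And>v. v \<in> verts G - K \<Longrightarrow> row_spanned (signed_adj G \<sigma>) (verts G) K v"
  shows "nullity G \<sigma> = card (verts G) - card K"
proof -
  obtain ks where ks: "set ks = K" "distinct ks"
    using finite_distinct_list finite_subset[OF KV fin] by blast
  obtain ls where ls: "set ls = verts G - K" "distinct ls"
    using finite_distinct_list fin by blast
  have vs: "distinct (ks @ ls)" "set (ks @ ls) = verts G" using ks ls KV by auto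
  have "nullity G \<sigma> = length ls"
    unfolding nullity_eq[OF vs] signed_adj_mat_def
    using order_char_poly_spanned[of "signed_adj G \<sigma>", OF signed_adj_commute vs(1)] ns span
    by (simp only: vs(2) ks ls signed_adj_def)
  also have "\<dots> = card (verts G - K)" using ls distinct_card by metis
  finally show ?thesis using KV fin by (simp add: card_Diff_subset finite_subset)
qed

text \<open>
  A nonzero solution on \<open>insert v K\<close> expresses row \<open>v\<close> by the rows in \<open>K\<close> as far as the columns
  in \<open>insert v K\<close> are concerned. If this expression failed in a column \<open>w\<close>, the Schur complement
  of \<open>K\<close> in the submatrix of \<open>K\<close>, \<open>v\<close>, \<open>w\<close> would be a symmetric matrix of order two with zero
  diagonal and nonzero entries off it, and \<open>K\<close> with both vertices would be nonsingular.
\<close>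

lemma row_spanned_of_maximal:
  assumes sym: "\<And>u v. a u v = a v u"
    and fin: "finite V" and KV: "K \<subseteq> V"
    and ns: "nonsingular_on a K"
    and max: "\<And>K'. K \<subset> K' \<Longrightarrow> K' \<subseteq> V \<Longrightarrow> \<not> nonsingular_on a K'"
    and v: "v \<in> V - K"
  shows "row_spanned a V K v"
proof -
  have finK: "finite K" using fin KV finite_subset by blast
  have "\<exists>c. \<forall>u\<in>insert v K. a v u = (\<Sum>w\<in>K. c w * a w u)" if v: "v \<in> V - K" for v
  proof -
    have "\<not> nonsingular_on a (insert v K)" using v KV by (intro max) auto
    then obtain x w where x: "\<And>u. u \<in> insert v K \<Longrightarrow> (\<Sum>v\<in>insert v K. a u v * x v) = 0"
      and w: "w \<in> insert v K" "x w \<noteq> 0"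
      unfolding nonsingular_on_def by blast
    have x': "a u v * x v + (\<Sum>w\<in>K. a u w * x w) = 0" if "u \<in> insert v K" for u
      using x[OF that] v finK by simp
    have xv: "x v \<noteq> 0"
    proof
      assume "x v = 0"
      then have "x u = 0" if "u \<in> K" for u
        using nonsingular_onD[OF ns, of x u] x' that by auto
      then show False using w \<open>x v = 0\<close> by auto
    qed
    have "a v u = (\<Sum>w\<in>K. - (x w / x v) * a w u)" if "u \<in> insert v K" for u
    proof -
      have "(\<Sum>w\<in>K. - (x w / x v) * a w u) = - (\<Sum>w\<in>K. a u w * x w) / x v"
        by (simp add: sum_divide_distrib sum_negf sym[of _ u] mult.commute)
      also have "\<dots> = a v u" using x'[OF that] xv sym[of u v] by (simp add: field_simps)
      finally show ?thesis ..
    qed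
    then show ?thesis by (intro exI[of _ "\<lambda>w. - (x w / x v)"]) blast
  qed
  then obtain c where c: "\<And>v u. v \<in> V - K \<Longrightarrow> u \<in> insert v K \<Longrightarrow> a v u = (\<Sum>w\<in>K. c v w * a w u)"
    by metis
  have "a v w = (\<Sum>u\<in>K. c v u * a u w)" if w: "w \<in> V" for w
  proof (rule ccontr)
    assume ne: "a v w \<noteq> (\<Sum>u\<in>K. c v u * a u w)"
    then have wK: "w \<in> V - K" and vw: "v \<noteq> w" using c[OF v, of w] w by auto
    \<comment> \<open>Subtracting the combination of the rows in \<open>K\<close> leaves row \<open>v\<close>, restricted to the columns in \<open>K\<close>, \<open>v\<close>, \<open>w\<close>, with its entry at \<open>w\<close> only.\<close>
    have elim: "x w = 0"
      if x: "\<And>u. u \<in> insert v (insert w K) \<Longrightarrow> (\<Sum>v\<in>insert v (insert w K). a u v * x v) = 0"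
        and v: "v \<in> V - K" and w: "w \<in> V - K" and vw: "v \<noteq> w"
        and ne: "a v w \<noteq> (\<Sum>u\<in>K. c v u * a u w)" for x v w
    proof -
      have row: "a u v * x v + a u w * x w + (\<Sum>t\<in>K. a u t * x t) = 0"
        if "u \<in> insert v (insert w K)" for u
        using x[OF that] v w vw finK by simp
      have "0 = (\<Sum>u\<in>K. c v u * (a u v * x v + a u w * x w + (\<Sum>t\<in>K. a u t * x t)))"
        using row by simp
      also have "\<dots> = (\<Sum>u\<in>K. c v u * a u v) * x v + (\<Sum>u\<in>K. c v u * a u w) * x w
          + (\<Sum>u\<in>K. \<Sum>t\<in>K. c v u * a u t * x t)"
        by (simp add: algebra_simps sum.distrib sum_distrib_left)
      also have "(\<Sum>u\<in>K. \<Sum>t\<in>K. c v u * a u t * x t) = (\<Sum>t\<in>K. a v t * x t)"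
        using c[OF v] by (subst sum.swap) (auto simp: sum_distrib_right intro!: sum.cong)
      also have "(\<Sum>u\<in>K. c v u * a u v) = a v v" using c[OF v, of v] by simp
      finally have "(a v w - (\<Sum>u\<in>K. c v u * a u w)) * x w = 0"
        using row[of v, OF insertI1] unfolding left_diff_distrib by linarith
      then show ?thesis using ne by simp
    qed
    have cross: "(\<Sum>u\<in>K. c v u * a u w) = (\<Sum>u\<in>K. c w u * a u v)"
    proof -
      have aw: "a u w = (\<Sum>t\<in>K. c w t * a u t)" if "u \<in> K" for u
        using c[OF wK, of u] that by (simp add: sym[of u])
      have av: "a t v = (\<Sum>u\<in>K. c v u * a u t)" if "t \<in> K" for t
        using c[OF v, of t] that by (simp add: sym[of t v])
      have "(\<Sum>u\<in>K. c v u * a u w) = (\<Sum>u\<in>K. \<Sum>t\<in>K. c w t * (c v u * a u t))"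
        by (intro sum.cong refl) (simp add: aw sum_distrib_left mult.left_commute)
      also have "\<dots> = (\<Sum>t\<in>K. \<Sum>u\<in>K. c w t * (c v u * a u t))"
        by (rule sum.swap)
      also have "\<dots> = (\<Sum>t\<in>K. c w t * a t v)"
        by (intro sum.cong refl) (simp add: av sum_distrib_left)
      finally show ?thesis .
    qed
    have "nonsingular_on a (insert v (insert w K))"
    proof (rule nonsingular_onI)
      fix x t
      assume x: "\<And>u. u \<in> insert v (insert w K) \<Longrightarrow> (\<Sum>v\<in>insert v (insert w K). a u v * x v) = 0"
        and t: "t \<in> insert v (insert w K)"
      have xw: "x w = 0" using elim[OF x v wK vw ne] by blast
      have xv: "x v = 0"
      proof (rule elim[of w v x])
        show "a w v \<noteq> (\<Sum>u\<in>K. c w u * a u v)" using ne cross sym by metis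
      qed (use x v wK vw in \<open>auto simp: insert_commute\<close>)
      have "x u = 0" if "u \<in> K" for u
        using nonsingular_onD[OF ns, of x u] x v wK vw xv xw finK that by simp
      then show "x t = 0" using t xv xw by blast
    qed
    moreover have "K \<subset> insert v (insert w K)" "insert v (insert w K) \<subseteq> V" using v wK KV by auto
    ultimately show False using max by blast
  qed
  then show ?thesis unfolding row_spanned_def by (intro exI[of _ "c v"]) blast
qed

lemma nullity_le_of_nonsingular:
  assumes fin: "finite (verts G)" and KV: "K \<subseteq> verts G"
    and ns: "nonsingular_on (signed_adj G \<sigma>) K"
  shows "nullity G \<sigma> \<le> card (verts G) - card K"
proof -
  define S where "S = {K'. K' \<subseteq> verts G \<and> nonsingular_on (signed_adj G \<sigma>) K'}"
  have "finite S" "K \<in> S" using assms by (auto simp: S_def)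
  then obtain M where M: "M \<in> S" "K \<subseteq> M" "\<forall>K'\<in>S. M \<subseteq> K' \<longrightarrow> M = K'"
    using finite_has_maximal2[of S K] by blast
  have MV: "M \<subseteq> verts G" and Mns: "nonsingular_on (signed_adj G \<sigma>) M"
    using M(1) by (simp_all add: S_def)
  have max: "\<not> nonsingular_on (signed_adj G \<sigma>) K'" if "M \<subset> K'" "K' \<subseteq> verts G" for K'
    using M(3) that by (auto simp: S_def)
  have "nullity G \<sigma> = card (verts G) - card M"
    using nullity_spanned[OF fin MV Mns]
      row_spanned_of_maximal[of "signed_adj G \<sigma>", OF signed_adj_commute fin MV Mns max] by blast
  moreover have "card K \<le> card M" using M(2) MV fin by (intro card_mono) (auto intro: finite_subset)
  ultimately show ?thesis by linarith
qed

lemma nonsingular_on_empty: "nonsingular_on a {}"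
  by (simp add: nonsingular_on_def)

text \<open>
  Row \<open>u\<close> reads \<open>a u w * x w = 0\<close>. With \<open>x w = 0\<close> the rows in \<open>K\<close> form the system of \<open>K\<close>, and
  then row \<open>w\<close> gives \<open>x u = 0\<close>.
\<close>

lemma nonsingular_on_pendant:
  assumes ns: "nonsingular_on a K" and fin: "finite K"
    and sym: "\<And>u v. a u v = a v u"
    and notin: "u \<notin> K" "w \<notin> K" "u \<noteq> w"
    and uu: "a u u = 0" and uw: "a u w \<noteq> 0" and uK: "\<And>v. v \<in> K \<Longrightarrow> a u v = 0"
  shows "nonsingular_on a (insert u (insert w K))"
proof (rule nonsingular_onI)
  fix x t
  assume x: "\<And>t. t \<in> insert u (insert w K) \<Longrightarrow> (\<Sum>v\<in>insert u (insert w K). a t v * x v) = 0"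
    and t: "t \<in> insert u (insert w K)"
  have row: "a t u * x u + a t w * x w + (\<Sum>v\<in>K. a t v * x v) = 0" if "t \<in> insert u (insert w K)" for t
    using x[OF that] notin fin by simp
  have xw: "x w = 0" using row[of u] uu uw uK by simp
  have "(\<Sum>v\<in>K. a t v * x v) = 0" if "t \<in> K" for t
    using row[of t] uK[OF that] sym[of t u] xw that by simp
  then have xK: "x v = 0" if "v \<in> K" for v
    using nonsingular_onD[OF ns, of x v] that by blast
  have "x u = 0" using row[of w] xw xK uw sym[of w u] by simp
  then show "x t = 0" using t xw xK by blast
qed

section \<open>Isomorphism with the graphs of the classification\<close>

lemma cycle_edges_image: "cycle_edges vs = (\<lambda>i. {vs ! i, vs ! (Suc i mod length vs)}) ` {..<length vs}"
  by (auto simp: cycle_edges_def)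

lemma cycle_edges_map: "(`) g ` cycle_edges vs = cycle_edges (map g vs)"
proof -
  have "(`) g ` cycle_edges vs = (\<lambda>i. {g (vs ! i), g (vs ! (Suc i mod length vs))}) ` {..<length vs}"
    by (simp add: cycle_edges_image image_image)
  also have "\<dots> = cycle_edges (map g vs)"
    unfolding cycle_edges_image length_map
    by (rule image_cong[OF refl], subst nth_map, simp, subst nth_map) (auto intro: mod_less_divisor)
  finally show ?thesis .
qed

lemma Union_cycle_edges: "\<Union>(cycle_edges vs) = set vs"
proof
  show "\<Union>(cycle_edges vs) \<subseteq> set vs"
  proof
    fix x assume "x \<in> \<Union>(cycle_edges vs)"
    then obtain i where i: "i < length vs" "x \<in> {vs ! i, vs ! (Suc i mod length vs)}"
      by (auto simp: cycle_edges_def)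
    then have "Suc i mod length vs < length vs" by (intro mod_less_divisor) auto
    with i show "x \<in> set vs" by (auto intro: nth_mem)
  qed
  show "set vs \<subseteq> \<Union>(cycle_edges vs)"
  proof
    fix x assume "x \<in> set vs"
    then obtain i where "i < length vs" "x = vs ! i" by (auto simp: in_set_conv_nth)
    then show "x \<in> \<Union>(cycle_edges vs)" unfolding cycle_edges_def by blast
  qed
qed

lemma cycle_edges_3: "cycle_edges [a, b, c] = {{a, b}, {b, c}, {c, a}}"
proof -
  have "{..<length [a, b, c]} = {0, 1, 2}" by auto
  then show ?thesis unfolding cycle_edges_image by simp
qed

lemma cycle_edges_4: "cycle_edges [a, b, c, d] = {{a, b}, {b, c}, {c, d}, {d, a}}"
proof -
  have "{..<length [a, b, c, d]} = {0, 1, 2, 3}" by auto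
  then show ?thesis unfolding cycle_edges_image by simp
qed

lemma cycle_edges_5: "cycle_edges [a, b, c, d, e] = {{a, b}, {b, c}, {c, d}, {d, e}, {e, a}}"
proof -
  have "{..<length [a, b, c, d, e]} = {0, 1, 2, 3, 4}" by auto
  then show ?thesis unfolding cycle_edges_image by simp
qed

lemma cycle_edges_6: "cycle_edges [a, b, c, d, e, f] = {{a, b}, {b, c}, {c, d}, {d, e}, {e, f}, {f, a}}"
proof -
  have "{..<length [a, b, c, d, e, f]} = {0, 1, 2, 3, 4, 5}" by auto
  then show ?thesis unfolding cycle_edges_image by simp
qed

lemma star_edges_image: "star_edges c L = (\<lambda>l. {c, l}) ` L"
  by (auto simp: star_edges_def)

lemma star_edges_map: "(`) g ` star_edges c L = star_edges (g c) (g ` L)"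
  by (simp add: star_edges_image image_image)

lemma star_edges_insert: "star_edges c (insert l L) = insert {c, l} (star_edges c L)"
  by (auto simp: star_edges_def)

lemma in_star_edges: "{u, v} \<in> star_edges c L \<longleftrightarrow> u = c \<and> v \<in> L \<or> v = c \<and> u \<in> L"
  by (auto simp: star_edges_def doubleton_eq_iff)

text \<open>
  An isomorphism onto a graph on \<open>{..<n}\<close> amounts to a list of the vertices. Lists make the
  concrete structure of the graphs of the classification accessible: a cycle becomes the list of
  its vertices, and a block of pendant vertices a segment.
\<close>

lemma graph_iso_iff_labelling:
  fixes H :: "nat ugraph"
  assumes G: "simple_graph G" and H: "simple_graph H" "verts H = {..<n}"
  shows "graph_iso G H \<longleftrightarrow>
    (\<exists>xs. length xs = n \<and> distinct xs \<and> verts G = set xs \<and> edges G = (\<lambda>e. (!) xs ` e) ` edges H)"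
    (is "_ \<longleftrightarrow> (\<exists>xs. ?L xs)")
proof
  have pair: "\<exists>u\<in>verts K. \<exists>v\<in>verts K. e = {u, v}" if "simple_graph K" "e \<in> edges K"
    for K :: "'b ugraph" and e
  proof -
    have "e \<subseteq> verts K" "card e = 2" using that by (auto simp: simple_graph_def)
    then show ?thesis by (auto simp: card_2_iff)
  qed
  assume "graph_iso G H"
  then obtain f where f: "bij_betw f (verts G) (verts H)"
    "\<And>u v. u \<in> verts G \<Longrightarrow> v \<in> verts G \<Longrightarrow> {u, v} \<in> edges G \<longleftrightarrow> {f u, f v} \<in> edges H"
    unfolding graph_iso_def by blast
  define g where "g = inv_into (verts G) f"
  define xs where "xs = map g [0..<n]"
  have g: "bij_betw g {..<n} (verts G)" using bij_betw_inv_into[OF f(1)] by (simp add: g_def H)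
  have gf: "g (f u) = u" if "u \<in> verts G" for u
    using f(1) that by (simp add: g_def bij_betw_inv_into_left)
  have nth: "xs ! i = g i" if "i < n" for i using that by (simp add: xs_def)
  have nth_im: "(!) xs ` e = g ` e" if "e \<in> edges H" for e
    using H that nth unfolding simple_graph_def by (intro image_cong) auto
  have "edges G = (\<lambda>e. (!) xs ` e) ` edges H"
  proof (intro equalityI subsetI)
    fix e assume e: "e \<in> edges G"
    then obtain u v where uv: "u \<in> verts G" "v \<in> verts G" "e = {u, v}" using pair[OF G] by blast
    then have H': "{f u, f v} \<in> edges H" using f(2) e by blast
    have "(!) xs ` {f u, f v} = e" unfolding nth_im[OF H'] using uv gf by simp
    then show "e \<in> (\<lambda>e. (!) xs ` e) ` edges H" using H' by blast
  next
    fix e assume "e \<in> (\<lambda>e. (!) xs ` e) ` edges H"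
    then obtain d where d: "d \<in> edges H" "e = (!) xs ` d" by blast
    then obtain i j where ij: "i \<in> verts H" "j \<in> verts H" "d = {i, j}" using pair[OF H(1)] by blast
    then have "f (g i) = i" "f (g j) = j" "g i \<in> verts G" "g j \<in> verts G"
      using f(1) g H(2) by (auto simp: g_def bij_betw_inv_into_right bij_betw_def)
    moreover have "e = {g i, g j}" using d(2) nth_im[OF d(1)] ij(3) by simp
    ultimately show "e \<in> edges G" using f(2)[of "g i" "g j"] d(1) ij(3) by simp
  qed
  moreover have "distinct xs" "set xs = verts G"
    using g by (auto simp: xs_def distinct_map bij_betw_def atLeast0LessThan)
  ultimately show "\<exists>xs. ?L xs" by (intro exI[of _ xs]) (auto simp: xs_def)
next
  assume "\<exists>xs. ?L xs"
  then obtain xs where xs: "length xs = n" "distinct xs" "verts G = set xs"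
    "edges G = (\<lambda>e. (!) xs ` e) ` edges H" by blast
  have g: "bij_betw ((!) xs) {..<n} (verts G)" using xs bij_betw_nth by blast
  then have inj: "inj_on ((!) xs) {..<n}" by (simp add: bij_betw_def)
  define f where "f = inv_into {..<n} ((!) xs)"
  have f: "bij_betw f (verts G) (verts H)" using bij_betw_inv_into[OF g] by (simp add: f_def H)
  have sub: "e \<subseteq> {..<n}" if "e \<in> edges H" for e using H that unfolding simple_graph_def by auto
  have fg: "xs ! f u = u" "f u \<in> {..<n}" if "u \<in> verts G" for u
    using that g f H unfolding f_def by (auto simp: bij_betw_inv_into_right bij_betw_def)
  have "{u, v} \<in> edges G \<longleftrightarrow> {f u, f v} \<in> edges H" if "u \<in> verts G" "v \<in> verts G" for u v
  proof -
    have im: "(!) xs ` {f u, f v} = {u, v}" using fg that by simp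
    show ?thesis
    proof
      assume "{u, v} \<in> edges G"
      then obtain e where e: "e \<in> edges H" "(!) xs ` e = {u, v}" using xs(4) by auto
      have "e = {f u, f v}"
        using inj_on_image_eq_iff[OF inj sub[OF e(1)], of "{f u, f v}"] e(2) im fg that by simp
      then show "{f u, f v} \<in> edges H" using e by simp
    next
      assume "{f u, f v} \<in> edges H"
      then show "{u, v} \<in> edges G" using xs(4) im by (metis image_eqI)
    qed
  qed
  then show "graph_iso G H" unfolding graph_iso_def using f by blast
qed

lemma simple_cycle_graph:
  assumes "3 \<le> m" shows "simple_graph (cycle_graph m)"
proof -
  have "e \<subseteq> {..<m} \<and> card e = 2" if e: "e \<in> cycle_edges [0..<m]" for e
  proof -
    obtain i where i: "i < m" "e = {i, Suc i mod m}"
      using e by (auto simp: cycle_edges_def)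
    have "Suc i mod m \<noteq> i" using i(1) assms by (cases "Suc i = m") auto
    moreover have "Suc i mod m < m" using assms by simp
    ultimately show ?thesis using i by auto
  qed
  then show ?thesis by (simp add: simple_graph_def cycle_graph_def)
qed

lemma edges_cycle_graph_subset:
  assumes "e \<in> edges (cycle_graph m)" "3 \<le> m" "m \<le> n"
  shows "e \<subseteq> {..<n} \<and> card e = 2"
  using assms simple_cycle_graph[of m] unfolding simple_graph_def by (fastforce simp: cycle_graph_def)

lemma simple_star_edges:
  assumes "e \<in> star_edges c L" "c \<notin> L" "insert c L \<subseteq> V"
  shows "e \<subseteq> V \<and> card e = 2"
  using assms by (auto simp: star_edges_def card_2_iff)

lemma simple_U1: "simple_graph (U1 r s)"
proof -
  have "e \<subseteq> {..<3 + r + s} \<and> card e = 2" if "e \<in> edges (cycle_graph 3)" for e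
    by (rule edges_cycle_graph_subset[OF that]) auto
  moreover have "e \<subseteq> {..<3 + r + s} \<and> card e = 2" if "e \<in> star_edges 0 {3..<3 + r}" for e
    by (rule simple_star_edges[OF that]) auto
  moreover have "e \<subseteq> {..<3 + r + s} \<and> card e = 2" if "e \<in> star_edges 1 {3 + r..<3 + r + s}" for e
    by (rule simple_star_edges[OF that]) auto
  ultimately show ?thesis unfolding simple_graph_def U1_def by auto
qed

lemma simple_U2: "simple_graph (U2 r s)"
proof -
  have "e \<subseteq> {..<4 + r + s} \<and> card e = 2" if "e \<in> edges (cycle_graph 4)" for e
    by (rule edges_cycle_graph_subset[OF that]) auto
  moreover have "e \<subseteq> {..<4 + r + s} \<and> card e = 2" if "e \<in> star_edges 0 {4..<4 + r}" for e
    by (rule simple_star_edges[OF that]) auto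
  moreover have "e \<subseteq> {..<4 + r + s} \<and> card e = 2" if "e \<in> star_edges 2 {4 + r..<4 + r + s}" for e
    by (rule simple_star_edges[OF that]) auto
  ultimately show ?thesis unfolding simple_graph_def U2_def by auto
qed

lemma simple_U3: "simple_graph (U3 r)"
proof -
  have "e \<subseteq> {..<5 + r} \<and> card e = 2" if "e \<in> edges (cycle_graph 4)" for e
    by (rule edges_cycle_graph_subset[OF that]) auto
  moreover have "e \<subseteq> {..<5 + r} \<and> card e = 2" if "e \<in> star_edges 4 (insert 0 {5..<5 + r})" for e
    by (rule simple_star_edges[OF that]) auto
  ultimately show ?thesis unfolding simple_graph_def U3_def by auto
qed

lemma graph_iso_cycle_iff:
  assumes "simple_graph G" "3 \<le> m"
  shows "graph_iso G (cycle_graph m) \<longleftrightarrow>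
    (\<exists>xs. length xs = m \<and> distinct xs \<and> G = (set xs, cycle_edges xs))"
proof -
  have "(\<lambda>e. (!) xs ` e) ` cycle_edges [0..<m] = cycle_edges xs" if "length xs = m" for xs :: "'a list"
    using that cycle_edges_map[of "(!) xs" "[0..<m]"] map_nth[of xs] by simp
  moreover have "graph_iso G (cycle_graph m) \<longleftrightarrow> (\<exists>xs. length xs = m \<and> distinct xs \<and>
      verts G = set xs \<and> edges G = (\<lambda>e. (!) xs ` e) ` edges (cycle_graph m))"
    by (rule graph_iso_iff_labelling[OF assms(1) simple_cycle_graph[OF assms(2)]])
      (simp add: cycle_graph_def)
  ultimately show ?thesis by (auto simp: prod_eq_iff cycle_graph_def)
qed

lemma nth_image_segment:
  "(!) (as @ bs @ cs) ` {length as..<length as + length bs} = set bs"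
proof -
  have "{length as..<length as + length bs} = (+) (length as) ` {0..<length bs}"
    by (simp add: add.commute)
  then have "(!) (as @ bs @ cs) ` {length as..<length as + length bs} = (!) bs ` {0..<length bs}"
    by (simp only: image_image) (rule image_cong, auto simp: nth_append)
  then show ?thesis by (auto simp: set_conv_nth)
qed

text \<open>
  The three families share one shape: a fixed graph \<open>B\<close> on \<open>{..<m}\<close>, followed by \<open>r\<close> vertices
  attached to \<open>i\<close> and \<open>s\<close> vertices attached to \<open>j\<close>.
\<close>

lemma labelling_pendant_stars:
  fixes xs :: "'a list"
  assumes xs: "length xs = m + r + s" "distinct xs" and i: "i < m" and j: "j < m"
    and B: "\<And>e. e \<in> B \<Longrightarrow> e \<subseteq> {..<m}"
  defines "vs \<equiv> take m xs" and "P \<equiv> set (take r (drop m xs))" and "Q \<equiv> set (drop (m + r) xs)"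
  shows "length vs = m" "distinct vs" "set vs \<inter> P = {}" "set vs \<inter> Q = {}" "P \<inter> Q = {}"
    "card P = r" "card Q = s" "set xs = set vs \<union> P \<union> Q"
    "(\<lambda>e. (!) xs ` e) ` (B \<union> star_edges i {m..<m + r} \<union> star_edges j {m + r..<m + r + s})
       = (\<lambda>e. (!) vs ` e) ` B \<union> star_edges (vs ! i) P \<union> star_edges (vs ! j) Q"
proof -
  define ps qs where "ps = take r (drop m xs)" and "qs = drop (m + r) xs"
  have split: "xs = vs @ ps @ qs"
    by (simp add: vs_def ps_def qs_def) (metis append_take_drop_id drop_drop add.commute)
  have len: "length vs = m" "length ps = r" "length qs = s"
    using xs by (auto simp: vs_def ps_def qs_def)
  have PQ: "P = set ps" "Q = set qs" by (simp_all add: P_def Q_def ps_def qs_def)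
  have d: "distinct (vs @ ps @ qs)" using xs(2) split by simp
  show "length vs = m" by fact
  show "distinct vs" "set vs \<inter> P = {}" "set vs \<inter> Q = {}" "P \<inter> Q = {}"
    using d by (auto simp: PQ)
  show "card P = r" "card Q = s" using d len by (auto simp: PQ distinct_card)
  show "set xs = set vs \<union> P \<union> Q" by (subst split) (auto simp: PQ)
  have P: "(!) xs ` {m..<m + r} = P"
    using nth_image_segment[of vs ps qs] len by (simp add: PQ flip: split)
  have Q: "(!) xs ` {m + r..<m + r + s} = Q"
    using nth_image_segment[of "vs @ ps" qs "[]"] len by (simp add: PQ flip: split)
  have nth: "xs ! k = vs ! k" if "k < m" for k using that len by (simp add: split nth_append)
  have "(\<lambda>e. (!) xs ` e) ` B = (\<lambda>e. (!) vs ` e) ` B"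
    using B nth by (intro image_cong) auto
  then show "(\<lambda>e. (!) xs ` e) ` (B \<union> star_edges i {m..<m + r} \<union> star_edges j {m + r..<m + r + s})
       = (\<lambda>e. (!) vs ` e) ` B \<union> star_edges (vs ! i) P \<union> star_edges (vs ! j) Q"
    by (simp add: image_Un star_edges_map P Q nth i j)
qed

lemma graph_iso_pendant_stars_iff:
  fixes G :: "'a ugraph"
  assumes G: "simple_graph G" and H: "simple_graph H" and ij: "i < m" "j < m"
    and B: "\<And>e. e \<in> B \<Longrightarrow> e \<subseteq> {..<m}"
    and Hdef: "H = ({..<m + r + s},
      B \<union> star_edges i {m..<m + r} \<union> star_edges j {m + r..<m + r + s})"
  shows "graph_iso G H \<longleftrightarrow>
    (\<exists>vs P Q. length vs = m \<and> distinct vs \<and> finite P \<and> finite Q \<and>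
       set vs \<inter> P = {} \<and> set vs \<inter> Q = {} \<and> P \<inter> Q = {} \<and> card P = r \<and> card Q = s \<and>
       G = (set vs \<union> P \<union> Q,
         (\<lambda>e. (!) vs ` e) ` B \<union> star_edges (vs ! i) P \<union> star_edges (vs ! j) Q))"
    (is "_ \<longleftrightarrow> ?R")
proof -
  have "graph_iso G H \<longleftrightarrow> (\<exists>xs. length xs = m + r + s \<and> distinct xs \<and> verts G = set xs \<and>
      edges G = (\<lambda>e. (!) xs ` e) ` edges H)"
    by (rule graph_iso_iff_labelling[OF G H]) (simp add: Hdef)
  also have "\<dots> \<longleftrightarrow> ?R"
  proof
    assume "\<exists>xs. length xs = m + r + s \<and> distinct xs \<and> verts G = set xs \<and>
      edges G = (\<lambda>e. (!) xs ` e) ` edges H"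
    then obtain xs where xs: "length xs = m + r + s" "distinct xs" "verts G = set xs"
      "edges G = (\<lambda>e. (!) xs ` e) ` edges H" by blast
    note l = labelling_pendant_stars[OF xs(1,2) ij B, of B]
    show ?R
      by (rule exI[of _ "take m xs"], rule exI[of _ "set (take r (drop m xs))"],
          rule exI[of _ "set (drop (m + r) xs)"])
        (use l xs(3,4) in \<open>simp add: prod_eq_iff Hdef\<close>)
  next
    assume ?R
    then obtain vs P Q where R: "length vs = m" "distinct vs" "finite P" "finite Q"
       "set vs \<inter> P = {}" "set vs \<inter> Q = {}" "P \<inter> Q = {}" "card P = r" "card Q = s"
       "G = (set vs \<union> P \<union> Q,
         (\<lambda>e. (!) vs ` e) ` B \<union> star_edges (vs ! i) P \<union> star_edges (vs ! j) Q)" by blast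
    obtain ps qs where pq: "set ps = P" "distinct ps" "set qs = Q" "distinct qs"
      using R(3,4) finite_distinct_list by metis
    define xs where "xs = vs @ ps @ qs"
    have len: "length ps = r" "length qs = s" using pq R distinct_card by metis+
    have xs: "length xs = m + r + s" "distinct xs" using R pq len by (auto simp: xs_def)
    have "take m xs = vs" "take r (drop m xs) = ps" "drop (m + r) xs = qs"
      using R(1) len by (auto simp: xs_def)
    with labelling_pendant_stars(8,9)[OF xs ij B, of B] R(10) pq
    have "verts G = set xs" "edges G = (\<lambda>e. (!) xs ` e) ` edges H"
      by (simp_all add: Hdef)
    then show "\<exists>xs. length xs = m + r + s \<and> distinct xs \<and> verts G = set xs \<and>
      edges G = (\<lambda>e. (!) xs ` e) ` edges H" using xs by blast
  qed
  finally show ?thesis .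
qed

text \<open>
  The graphs \<open>U1\<close>, \<open>U2\<close> and \<open>U3\<close> on arbitrary vertices, with the sets of pendant vertices as
  parameters instead of their sizes.
\<close>

definition triangle_stars :: "'a \<Rightarrow> 'a \<Rightarrow> 'a \<Rightarrow> 'a set \<Rightarrow> 'a set \<Rightarrow> 'a ugraph" where
  "triangle_stars a b c P Q =
     ({a, b, c} \<union> P \<union> Q, cycle_edges [a, b, c] \<union> star_edges a P \<union> star_edges b Q)"

definition square_stars :: "'a \<Rightarrow> 'a \<Rightarrow> 'a \<Rightarrow> 'a \<Rightarrow> 'a set \<Rightarrow> 'a set \<Rightarrow> 'a ugraph" where
  "square_stars a b c d P Q =
     ({a, b, c, d} \<union> P \<union> Q, cycle_edges [a, b, c, d] \<union> star_edges a P \<union> star_edges c Q)"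

definition square_hung_star :: "'a \<Rightarrow> 'a \<Rightarrow> 'a \<Rightarrow> 'a \<Rightarrow> 'a \<Rightarrow> 'a set \<Rightarrow> 'a ugraph" where
  "square_hung_star a b c d e P =
     ({a, b, c, d, e} \<union> P, cycle_edges [a, b, c, d] \<union> star_edges e (insert a P))"

lemma map_nth_cycle: "(\<lambda>e. (!) vs ` e) ` cycle_edges [0..<length vs] = cycle_edges vs"
  using cycle_edges_map[of "(!) vs" "[0..<length vs]"] map_nth[of vs] by simp

lemma length_3: "length xs = 3 \<longleftrightarrow> (\<exists>a b c. xs = [a, b, c])"
  by (auto simp: length_Suc_conv eval_nat_numeral)

lemma length_4: "length xs = 4 \<longleftrightarrow> (\<exists>a b c d. xs = [a, b, c, d])"
  by (auto simp: length_Suc_conv eval_nat_numeral)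

lemma length_5: "length xs = 5 \<longleftrightarrow> (\<exists>a b c d e. xs = [a, b, c, d, e])"
  by (auto simp: length_Suc_conv eval_nat_numeral)

lemma ex_length_3:
  "(\<exists>vs P Q. length vs = 3 \<and> R vs P Q) \<longleftrightarrow> (\<exists>a b c P Q. R [a, b, c] P Q)"
  unfolding length_3 by blast

lemma ex_length_4:
  "(\<exists>vs P Q. length vs = 4 \<and> R vs P Q) \<longleftrightarrow> (\<exists>a b c d P Q. R [a, b, c, d] P Q)"
  unfolding length_4 by blast

lemma ex_length_5:
  "(\<exists>vs P Q. length vs = 5 \<and> R vs P Q) \<longleftrightarrow> (\<exists>a b c d e P Q. R [a, b, c, d, e] P Q)"
  unfolding length_5 by blast

lemma length_6: "length xs = 6 \<longleftrightarrow> (\<exists>a b c d e f. xs = [a, b, c, d, e, f])"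
  by (auto simp: length_Suc_conv eval_nat_numeral)

lemma cycle_edges_upt_bound:
  assumes "e \<in> cycle_edges [0..<m]" "3 \<le> m" "m \<le> n" shows "e \<subseteq> {..<n}"
  using edges_cycle_graph_subset[of e m n] assms by (simp add: cycle_graph_def)

lemma graph_iso_U1_iff:
  assumes G: "simple_graph G"
  shows "graph_iso G (U1 r s) \<longleftrightarrow> (\<exists>a b c P Q. distinct [a, b, c] \<and> finite P \<and> finite Q \<and>
    {a, b, c} \<inter> P = {} \<and> {a, b, c} \<inter> Q = {} \<and> P \<inter> Q = {} \<and> card P = r \<and> card Q = s \<and>
    G = triangle_stars a b c P Q)" (is "_ \<longleftrightarrow> ?R")
proof -
  have "graph_iso G (U1 r s) \<longleftrightarrow> (\<exists>vs P Q. length vs = 3 \<and> distinct vs \<and> finite P \<and> finite Q \<and>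
       set vs \<inter> P = {} \<and> set vs \<inter> Q = {} \<and> P \<inter> Q = {} \<and> card P = r \<and> card Q = s \<and>
       G = (set vs \<union> P \<union> Q,
         (\<lambda>e. (!) vs ` e) ` cycle_edges [0..<3] \<union> star_edges (vs ! 0) P \<union> star_edges (vs ! 1) Q))"
    by (rule graph_iso_pendant_stars_iff[OF G simple_U1])
      (auto simp: U1_def cycle_graph_def dest: cycle_edges_upt_bound)
  also have "\<dots> \<longleftrightarrow> ?R"
  proof -
    have "(\<lambda>e. (!) [a, b, c] ` e) ` cycle_edges [0..<3] = cycle_edges [a, b, c]" for a b c :: 'a
      using map_nth_cycle[of "[a, b, c]"] by (simp add: numeral_eq_Suc)
    then show ?thesis unfolding ex_length_3 triangle_stars_def by simp
  qed
  finally show ?thesis .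
qed

lemma graph_iso_U2_iff:
  assumes G: "simple_graph G"
  shows "graph_iso G (U2 r s) \<longleftrightarrow> (\<exists>a b c d P Q. distinct [a, b, c, d] \<and> finite P \<and> finite Q \<and>
    {a, b, c, d} \<inter> P = {} \<and> {a, b, c, d} \<inter> Q = {} \<and> P \<inter> Q = {} \<and> card P = r \<and> card Q = s \<and>
    G = square_stars a b c d P Q)" (is "_ \<longleftrightarrow> ?R")
proof -
  have "graph_iso G (U2 r s) \<longleftrightarrow> (\<exists>vs P Q. length vs = 4 \<and> distinct vs \<and> finite P \<and> finite Q \<and>
       set vs \<inter> P = {} \<and> set vs \<inter> Q = {} \<and> P \<inter> Q = {} \<and> card P = r \<and> card Q = s \<and>
       G = (set vs \<union> P \<union> Q,
         (\<lambda>e. (!) vs ` e) ` cycle_edges [0..<4] \<union> star_edges (vs ! 0) P \<union> star_edges (vs ! 2) Q))"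
    by (rule graph_iso_pendant_stars_iff[OF G simple_U2])
      (auto simp: U2_def cycle_graph_def dest: cycle_edges_upt_bound)
  also have "\<dots> \<longleftrightarrow> ?R"
  proof -
    have "(\<lambda>e. (!) [a, b, c, d] ` e) ` cycle_edges [0..<4] = cycle_edges [a, b, c, d]" for a b c d :: 'a
      using map_nth_cycle[of "[a, b, c, d]"] by (simp add: numeral_eq_Suc)
    then show ?thesis unfolding ex_length_4 square_stars_def by (simp add: numeral_2_eq_2)
  qed
  finally show ?thesis .
qed

lemma graph_iso_U3_iff:
  assumes G: "simple_graph G"
  shows "graph_iso G (U3 r) \<longleftrightarrow> (\<exists>a b c d e P. distinct [a, b, c, d, e] \<and> finite P \<and>
    {a, b, c, d, e} \<inter> P = {} \<and> card P = r \<and> G = square_hung_star a b c d e P)" (is "_ \<longleftrightarrow> ?R")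
proof -
  have "graph_iso G (U3 r) \<longleftrightarrow> (\<exists>vs P Q. length vs = 5 \<and> distinct vs \<and> finite P \<and> finite Q \<and>
       set vs \<inter> P = {} \<and> set vs \<inter> Q = {} \<and> P \<inter> Q = {} \<and> card P = r \<and> card Q = 0 \<and>
       G = (set vs \<union> P \<union> Q,
         (\<lambda>e. (!) vs ` e) ` insert {4, 0} (cycle_edges [0..<4]) \<union> star_edges (vs ! 4) P \<union> star_edges (vs ! 4) Q))"
    \<comment> \<open>The edge from the square to the centre of the star belongs to the fixed part, and \<open>s = 0\<close>.\<close>
    by (rule graph_iso_pendant_stars_iff[OF G simple_U3])
      (auto simp: U3_def cycle_graph_def star_edges_insert star_edges_image dest: cycle_edges_upt_bound[of _ 4 5])
  also have "\<dots> \<longleftrightarrow> ?R"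
  proof -
    have im: "(\<lambda>x. (!) [a, b, c, d, e] ` x) ` cycle_edges [0..<4] = cycle_edges [a, b, c, d]"
      for a b c d e :: 'a
      unfolding cycle_edges_map by (simp add: upt_rec)
    have im': "({a, b, c, d, e} \<union> P \<union> {}, (\<lambda>x. (!) [a, b, c, d, e] ` x) ` insert {4, 0} (cycle_edges [0..<4]) \<union>
        star_edges e P \<union> star_edges e {}) = square_hung_star a b c d e P" for a b c d e :: 'a and P
      by (simp add: im square_hung_star_def star_edges_insert) (simp add: star_edges_image)
    have Q: "finite Q \<and> card Q = 0 \<longleftrightarrow> Q = {}" for Q :: "'a set" by auto
    have "(\<exists>Q. distinct [a, b, c, d, e] \<and> finite P \<and> finite Q \<and> set [a, b, c, d, e] \<inter> P = {} \<and>
        set [a, b, c, d, e] \<inter> Q = {} \<and> P \<inter> Q = {} \<and> card P = r \<and> card Q = 0 \<and>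
        G = (set [a, b, c, d, e] \<union> P \<union> Q, (\<lambda>x. (!) [a, b, c, d, e] ` x) ` insert {4, 0} (cycle_edges [0..<4]) \<union>
          star_edges ([a, b, c, d, e] ! 4) P \<union> star_edges ([a, b, c, d, e] ! 4) Q)) \<longleftrightarrow>
      distinct [a, b, c, d, e] \<and> finite P \<and> {a, b, c, d, e} \<inter> P = {} \<and> card P = r \<and>
      G = square_hung_star a b c d e P" (is "(\<exists>Q. ?F Q) \<longleftrightarrow> ?F'") for a b c d e P
    proof -
      have empty: "?F Q \<Longrightarrow> Q = {}" for Q using Q[of Q] by blast
      have "(\<exists>Q. ?F Q) \<longleftrightarrow> ?F {}"
        by (rule iffI, erule exE, frule empty, hypsubst, assumption, rule exI)
      also have "\<dots> \<longleftrightarrow> ?F'" unfolding im'[symmetric] by simp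
      finally show ?thesis .
    qed
    then show ?thesis
      unfolding ex_length_5 by simp
  qed
  finally show ?thesis .
qed

section \<open>Nonsingular induced subgraphs\<close>

lemma sign_eqn: "p \<in> {1, -1} \<Longrightarrow> q \<in> {1, -1} \<Longrightarrow> p * y + q * z = 0 \<Longrightarrow> y = - (p * q) * (z :: real)"
  by auto

text \<open>
  In this locale \<open>E\<close> is adjacency and \<open>s\<close> the signed adjacency matrix as a function of two
  vertices.
\<close>

locale signed =
  fixes G :: "'a ugraph" and \<sigma> :: "'a set \<Rightarrow> real"
  assumes signed: "signed_graph G \<sigma>"
begin

abbreviation s :: "'a \<Rightarrow> 'a \<Rightarrow> real" where "s \<equiv> signed_adj G \<sigma>"

definition E :: "'a \<Rightarrow> 'a \<Rightarrow> bool" where "E u v \<longleftrightarrow> {u, v} \<in> edges G"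

lemma simple: "simple_graph G"
  using signed by (simp add: signed_graph_def)

lemma finite_verts: "finite (verts G)"
  using simple by (simp add: simple_graph_def)

lemma E_commute: "E u v \<longleftrightarrow> E v u"
  by (simp add: E_def insert_commute)

lemma E_irrefl [simp]: "\<not> E u u"
  using simple by (auto simp: E_def simple_graph_def)

lemma E_verts: "E u v \<Longrightarrow> u \<in> verts G" "E u v \<Longrightarrow> v \<in> verts G"
  using simple by (auto simp: E_def simple_graph_def)

lemma s_eq_0: "\<not> E u v \<Longrightarrow> s u v = 0"
  by (simp add: signed_adj_def adj_def E_def)

lemma s_eq: "E u v \<Longrightarrow> s u v = \<sigma> {u, v}"
  by (simp add: signed_adj_def adj_def E_def)

lemma s_sign: "E u v \<Longrightarrow> s u v \<in> {1, -1}"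
  using signed by (auto simp: signed_adj_def adj_def E_def signed_graph_def)

lemma s_square: "E u v \<Longrightarrow> s u v * s u v = 1"
  using s_sign[of u v] by auto

lemma s_square_cancel: "E u v \<Longrightarrow> x * s u v * s u v = x"
  by (simp add: mult.assoc s_square)

lemma s_commute: "s u v = s v u"
  by (rule signed_adj_commute)

lemma nonsingular_on_insert_pair:
  assumes "nonsingular_on s K" "finite K" "u \<notin> K" "w \<notin> K" "E u w" "\<And>v. v \<in> K \<Longrightarrow> \<not> E u v"
  shows "nonsingular_on s (insert u (insert w K))"
  by (rule nonsingular_on_pendant)
    (use assms s_sign[of u w] in \<open>auto simp: s_eq_0 intro: s_commute\<close>)

lemma nonsingular_on_two_pairs:
  assumes "E u1 w1" "E u2 w2" "distinct [u1, w1, u2, w2]" "\<not> E u1 u2" "\<not> E u1 w2"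
  shows "nonsingular_on s {u1, w1, u2, w2}"
  by (intro nonsingular_on_insert_pair nonsingular_on_empty) (use assms in auto)

lemma nonsingular_on_three_pairs:
  assumes "E u1 w1" "E u2 w2" "E u3 w3" "distinct [u1, w1, u2, w2, u3, w3]"
    "\<not> E u1 u2" "\<not> E u1 w2" "\<not> E u1 u3" "\<not> E u1 w3" "\<not> E u2 u3" "\<not> E u2 w3"
  shows "nonsingular_on s {u1, w1, u2, w2, u3, w3}"
  by (intro nonsingular_on_insert_pair nonsingular_on_empty) (use assms in auto)

text \<open>
  The determinant is twice the product of the three signs.
\<close>

lemma nonsingular_on_triangle:
  assumes E: "E a b" "E b c" "E c a"
  shows "nonsingular_on s {a, b, c}"
proof (rule nonsingular_onI)
  have d: "a \<noteq> b" "b \<noteq> c" "a \<noteq> c" using E by auto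
  fix x v assume x: "\<And>u. u \<in> {a, b, c} \<Longrightarrow> (\<Sum>v\<in>{a, b, c}. s u v * x v) = 0" and v: "v \<in> {a, b, c}"
  have x': "s u a * x a + s u b * x b + s u c * x c = 0" if "u \<in> {a, b, c}" for u
    using x[OF that] d by (simp add: add.assoc)
  have "s a b * x b + s c a * x c = 0" "s a b * x a + s b c * x c = 0" "s c a * x a + s b c * x b = 0"
    using x'[of a] x'[of b] x'[of c] s_commute[of b a] s_commute[of a c] s_commute[of c b]
    by (simp_all add: s_eq_0)
  then show "x v = 0" using s_sign[OF E(1)] s_sign[OF E(2)] s_sign[OF E(3)] v by auto
qed

text \<open>
  Each row determines one coordinate from another up to sign. Since \<open>2\<close> is coprime to \<open>5\<close>, these
  steps of length two run once through all coordinates. Every edge is used twice, so the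
  signs cancel except for the factor \<open>-1\<close> of each of the five steps, and \<open>x e = - x e\<close>.
\<close>

lemma nonsingular_on_pentagon:
  assumes E: "E a b" "E b c" "E c d" "E d e" "E e a" and dist: "distinct [a, b, c, d, e]"
    and nE: "\<not> E a c" "\<not> E a d" "\<not> E b d" "\<not> E b e" "\<not> E c e"
  shows "nonsingular_on s {a, b, c, d, e}"
proof (rule nonsingular_onI)
  fix x v assume x: "\<And>u. u \<in> {a, b, c, d, e} \<Longrightarrow> (\<Sum>v\<in>{a, b, c, d, e}. s u v * x v) = 0"
    and v: "v \<in> {a, b, c, d, e}"
  have x': "s u a * x a + s u b * x b + s u c * x c + s u d * x d + s u e * x e = 0"
    if "u \<in> {a, b, c, d, e}" for u
    using x[OF that] dist by (simp add: add.assoc)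
  have nE': "\<not> E c a" "\<not> E d a" "\<not> E d b" "\<not> E e b" "\<not> E e c" using nE E_commute by blast+
  have r: "s a b * x b + s e a * x e = 0" "s c d * x d + s b c * x b = 0" "s e a * x a + s d e * x d = 0"
    "s b c * x c + s a b * x a = 0" "s d e * x e + s c d * x c = 0"
    using x'[of a] x'[of b] x'[of c] x'[of d] x'[of e]
      s_commute[of b a] s_commute[of c b] s_commute[of d c] s_commute[of e d] s_commute[of a e]
    by (simp_all add: s_eq_0 nE nE' add.commute)
  note sg = s_sign[OF E(1)] s_sign[OF E(2)] s_sign[OF E(3)] s_sign[OF E(4)] s_sign[OF E(5)]
  note q = sign_eqn[OF sg(1,5) r(1)] sign_eqn[OF sg(3,2) r(2)] sign_eqn[OF sg(5,4) r(3)]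
    sign_eqn[OF sg(2,1) r(4)] sign_eqn[OF sg(4,3) r(5)]
  have c: "x c = - (s b c * s a b) * (- (s e a * s d e) * (- (s c d * s b c) * (- (s a b * s e a) * x e)))"
    by (subst q(4), subst q(3), subst q(2), subst q(1)) (rule refl)
  have "x e = - ((s d e * s d e) * (s c d * s c d) * (s b c * s b c) * (s a b * s a b) * (s e a * s e a)) * x e"
    using q(5)[unfolded c] by (simp only: mult_minus_left mult_minus_right minus_minus mult_ac)
  then have xe: "x e = 0" by (simp add: s_square E)
  have xb: "x b = 0" using q(1) xe by simp
  have xd: "x d = 0" using q(2) xb by simp
  have xa: "x a = 0" using q(3) xd by simp
  have xc: "x c = 0" using q(4) xa by simp
  show "x v = 0" using xa xb xc xd xe v by blast
qed

lemma nonsingular_on_negative_square: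
  assumes E: "E a b" "E b c" "E c d" "E d a" and dist: "distinct [a, b, c, d]"
    and nE: "\<not> E a c" "\<not> E b d" and neg: "s a b * s b c * s c d * s d a = -1"
  shows "nonsingular_on s {a, b, c, d}"
proof (rule nonsingular_onI)
  fix x v assume x: "\<And>u. u \<in> {a, b, c, d} \<Longrightarrow> (\<Sum>v\<in>{a, b, c, d}. s u v * x v) = 0"
    and v: "v \<in> {a, b, c, d}"
  have x': "s u a * x a + s u b * x b + s u c * x c + s u d * x d = 0"
    if "u \<in> {a, b, c, d}" for u
    using x[OF that] dist by (simp add: add.assoc)
  have nE': "\<not> E c a" "\<not> E d b" using nE E_commute by blast+
  have "s a b * x b + s d a * x d = 0" "s b c * x b + s c d * x d = 0"
    "s a b * x a + s b c * x c = 0" "s d a * x a + s c d * x c = 0"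
    using x'[of a] x'[of b] x'[of c] x'[of d]
      s_commute[of b a] s_commute[of c b] s_commute[of d c] s_commute[of a d]
    by (simp_all add: s_eq_0 nE nE')
  then show "x v = 0"
    using neg s_sign[OF E(1)] s_sign[OF E(2)] s_sign[OF E(3)] s_sign[OF E(4)] v by auto
qed

text \<open>
  Here the steps of length two split the coordinates into two classes of three. Running once
  through a class uses every edge once, so it gives \<open>x f = - x f\<close> for a positive hexagon, and no
  condition for a negative one.
\<close>

lemma nonsingular_on_positive_hexagon:
  assumes E: "E a b" "E b c" "E c d" "E d e" "E e f" "E f a" and dist: "distinct [a, b, c, d, e, f]"
    and nE: "\<not> E a c" "\<not> E a d" "\<not> E a e" "\<not> E b d" "\<not> E b e" "\<not> E b f" "\<not> E c e" "\<not> E c f" "\<not> E d f"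
    and pos: "s a b * s b c * s c d * s d e * s e f * s f a = 1"
  shows "nonsingular_on s {a, b, c, d, e, f}"
proof (rule nonsingular_onI)
  fix x v assume x: "\<And>u. u \<in> {a, b, c, d, e, f} \<Longrightarrow> (\<Sum>v\<in>{a, b, c, d, e, f}. s u v * x v) = 0"
    and v: "v \<in> {a, b, c, d, e, f}"
  have x': "s u a * x a + s u b * x b + s u c * x c + s u d * x d + s u e * x e + s u f * x f = 0"
    if "u \<in> {a, b, c, d, e, f}" for u
    using x[OF that] dist by (simp add: add.assoc)
  have nE': "\<not> E c a" "\<not> E d a" "\<not> E e a" "\<not> E d b" "\<not> E e b" "\<not> E f b" "\<not> E e c" "\<not> E f c" "\<not> E f d"
    using nE E_commute by blast+
  have r: "s a b * x b + s f a * x f = 0" "s c d * x d + s b c * x b = 0" "s e f * x f + s d e * x d = 0"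
    "s b c * x c + s a b * x a = 0" "s d e * x e + s c d * x c = 0" "s f a * x a + s e f * x e = 0"
    using x'[of a] x'[of b] x'[of c] x'[of d] x'[of e] x'[of f]
      s_commute[of b a] s_commute[of c b] s_commute[of d c] s_commute[of e d] s_commute[of f e] s_commute[of a f]
    by (simp_all add: s_eq_0 nE nE' add.commute)
  note sg = s_sign[OF E(1)] s_sign[OF E(2)] s_sign[OF E(3)] s_sign[OF E(4)] s_sign[OF E(5)] s_sign[OF E(6)]
  note q = sign_eqn[OF sg(1,6) r(1)] sign_eqn[OF sg(3,2) r(2)] sign_eqn[OF sg(5,4) r(3)]
    sign_eqn[OF sg(2,1) r(4)] sign_eqn[OF sg(4,3) r(5)] sign_eqn[OF sg(6,5) r(6)]
  have d: "x d = - (s c d * s b c) * (- (s a b * s f a) * x f)"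
    by (subst q(2), subst q(1)) (rule refl)
  have "x f = - (s a b * s b c * s c d * s d e * s e f * s f a) * x f"
    using q(3)[unfolded d] by (simp only: mult_minus_left mult_minus_right minus_minus mult_ac)
  then have xf: "x f = 0" unfolding pos by simp
  have e: "x e = - (s d e * s c d) * (- (s b c * s a b) * x a)"
    by (subst q(5), subst q(4)) (rule refl)
  have "x a = - (s a b * s b c * s c d * s d e * s e f * s f a) * x a"
    using q(6)[unfolded e] by (simp only: mult_minus_left mult_minus_right minus_minus mult_ac)
  then have xa: "x a = 0" unfolding pos by simp
  have xb: "x b = 0" using q(1) xf by simp
  have xd: "x d = 0" using q(2) xb by simp
  have xc: "x c = 0" using q(4) xa by simp
  have xe: "x e = 0" using q(5) xc by simp
  show "x v = 0" using xa xb xc xd xe xf v by blast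
qed

lemma row_spanned_two:
  assumes "finite K" "u1 \<in> K" "u2 \<in> K" "\<And>w. s v w = c1 * s u1 w + c2 * s u2 w"
  shows "row_spanned s V K v"
proof -
  let ?c = "\<lambda>u. (if u = u1 then c1 else 0) + (if u = u2 then c2 else 0)"
  have "(\<Sum>u\<in>K. ?c u * s u w) = c1 * s u1 w + c2 * s u2 w" for w
    using assms(1-3) by (simp add: distrib_right sum.distrib if_distrib[of "\<lambda>t. t * _"] cong: if_cong)
  then show ?thesis unfolding row_spanned_def using assms(4) by (intro exI[of _ ?c]) simp
qed

lemma row_spanned_leaf:
  assumes K: "finite K" "p \<in> K" and p: "\<And>w. E p w \<longleftrightarrow> w = a" and v: "\<And>w. E v w \<Longrightarrow> w = a"
  shows "row_spanned s V K v"
proof (rule row_spanned_two[OF K(1) K(2) K(2)])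
  fix w
  have "E p a" using p by simp
  moreover have "\<not> E v w" "\<not> E p w" if "w \<noteq> a" using p v that by blast+
  ultimately show "s v w = (s v a * s p a) * s p w + 0 * s p w"
    by (cases "w = a") (auto simp: s_eq_0 s_square_cancel)
qed

text \<open>
  A leaf \<open>p\<close> at \<open>a\<close> and a vertex \<open>t\<close> with the neighbours \<open>a\<close> and \<open>e\<close> together span the unit
  vectors of \<open>a\<close> and \<open>e\<close>, so every row supported on these two columns.
\<close>

lemma row_spanned_leaf_pair:
  assumes K: "finite K" "p \<in> K" "t \<in> K" and p: "\<And>w. E p w \<longleftrightarrow> w = a"
    and t: "\<And>w. E t w \<longleftrightarrow> w = a \<or> w = e" and ae: "a \<noteq> e" and v: "\<And>w. E v w \<Longrightarrow> w = a \<or> w = e"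
  shows "row_spanned s V K v"
proof (rule row_spanned_two[OF K])
  fix w
  define \<alpha> where "\<alpha> = s v e * s t e"
  have E: "E p a" "E t e" using p t by auto
  consider "w = a" | "w = e" | "w \<noteq> a" "w \<noteq> e" by blast
  then show "s v w = ((s v a - \<alpha> * s t a) * s p a) * s p w + \<alpha> * s t w"
  proof cases
    case 1
    then show ?thesis by (simp add: s_square_cancel[OF E(1)])
  next
    case 2
    then show ?thesis using p[of e] ae s_square[OF E(2)] by (simp add: \<alpha>_def s_eq_0)
  next
    case 3
    then have "\<not> E v w" "\<not> E p w" "\<not> E t w" using p t v by blast+
    then show ?thesis by (simp add: s_eq_0)
  qed
qed

lemma nullity_four:
  assumes "K \<subseteq> verts G" "card K = 4" "nonsingular_on s K"
    "\<And>v. v \<in> verts G - K \<Longrightarrow> row_spanned s (verts G) K v"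
  shows "nullity G \<sigma> = card (verts G) - 4"
  using nullity_spanned[OF finite_verts assms(1,3)] assms(2,4) by simp

text \<open>
  All vertices outside \<open>{p, a, b, c}\<close> have their neighbours in \<open>{a, b}\<close>, and these two unit
  vectors are spanned by the rows of the leaf \<open>p\<close> and of the third vertex \<open>c\<close> of the triangle.
\<close>

lemma nullity_triangle_stars:
  assumes G: "G = triangle_stars a b c P Q" and d: "distinct [a, b, c]"
    and disj: "{a, b, c} \<inter> P = {}" "{a, b, c} \<inter> Q = {}" "P \<inter> Q = {}" and p: "p \<in> P"
  shows "nullity G \<sigma> = card (verts G) - 4"
proof (rule nullity_four)
  have ed: "edges G = cycle_edges [a, b, c] \<union> star_edges a P \<union> star_edges b Q"
    by (simp add: G triangle_stars_def)
  have E: "E u v \<longleftrightarrow> {u, v} = {a, b} \<or> {u, v} = {b, c} \<or> {u, v} = {c, a} \<or>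
      u = a \<and> v \<in> P \<or> v = a \<and> u \<in> P \<or> u = b \<and> v \<in> Q \<or> v = b \<and> u \<in> Q" for u v
    by (simp only: E_def ed cycle_edges_3 Un_iff in_star_edges insert_iff empty_iff disj_assoc simp_thms)
  have Ep: "E p w \<longleftrightarrow> w = a" for w using d disj p by (auto simp: E doubleton_eq_iff)
  have Ec: "E c w \<longleftrightarrow> w = a \<or> w = b" for w using d disj by (auto simp: E doubleton_eq_iff)
  show "{p, a, b, c} \<subseteq> verts G" using p by (auto simp: G triangle_stars_def)
  have pn: "p \<notin> {a, b, c}" using p disj by blast
  then show "card {p, a, b, c} = 4" using d by simp
  have Ebc: "E b c" by (simp add: E)
  show "nonsingular_on s {p, a, b, c}"
    by (rule nonsingular_on_two_pairs[OF _ Ebc]) (use d p disj Ep in auto)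
  fix v assume "v \<in> verts G - {p, a, b, c}"
  then have v: "v \<in> P \<or> v \<in> Q" by (auto simp: G triangle_stars_def)
  show "row_spanned s (verts G) {p, a, b, c} v"
    by (rule row_spanned_leaf_pair[OF _ _ _ Ep Ec]) (use v d disj in \<open>auto simp: E doubleton_eq_iff\<close>)
qed

lemma nullity_square_stars:
  assumes G: "G = square_stars a b c d P Q" and d: "distinct [a, b, c, d]"
    and disj: "{a, b, c, d} \<inter> P = {}" "{a, b, c, d} \<inter> Q = {}" "P \<inter> Q = {}" and p: "p \<in> P"
  shows "nullity G \<sigma> = card (verts G) - 4"
proof (rule nullity_four)
  have ed: "edges G = cycle_edges [a, b, c, d] \<union> star_edges a P \<union> star_edges c Q"
    by (simp add: G square_stars_def)
  have E: "E u v \<longleftrightarrow> {u, v} = {a, b} \<or> {u, v} = {b, c} \<or> {u, v} = {c, d} \<or> {u, v} = {d, a} \<or>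
      u = a \<and> v \<in> P \<or> v = a \<and> u \<in> P \<or> u = c \<and> v \<in> Q \<or> v = c \<and> u \<in> Q" for u v
    by (simp only: E_def ed cycle_edges_4 Un_iff in_star_edges insert_iff empty_iff disj_assoc simp_thms)
  have Ep: "E p w \<longleftrightarrow> w = a" for w using d disj p by (auto simp: E doubleton_eq_iff)
  have Eb: "E b w \<longleftrightarrow> w = a \<or> w = c" for w using d disj by (auto simp: E doubleton_eq_iff)
  show "{p, a, b, c} \<subseteq> verts G" using p by (auto simp: G square_stars_def)
  have pn: "p \<notin> {a, b, c}" using p disj by blast
  then show "card {p, a, b, c} = 4" using d by simp
  have Ebc: "E b c" by (simp add: E)
  show "nonsingular_on s {p, a, b, c}"
    by (rule nonsingular_on_two_pairs[OF _ Ebc]) (use d p disj Ep in auto)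
  fix v assume "v \<in> verts G - {p, a, b, c}"
  then have v: "v \<in> P \<or> v \<in> Q \<or> v = d" by (auto simp: G square_stars_def)
  show "row_spanned s (verts G) {p, a, b, c} v"
    by (rule row_spanned_leaf_pair[OF _ _ _ Ep Eb]) (use v d disj in \<open>auto simp: E doubleton_eq_iff\<close>)
qed

text \<open>
  In a positive square, opposite vertices have proportional rows if only the edges of the square
  count. This accounts for \<open>d\<close> directly, and for \<open>c\<close> after the entry of \<open>a\<close> in the column of the
  centre \<open>e\<close> is removed by the row of the leaf \<open>p\<close>.
\<close>

lemma nullity_square_hung_star:
  assumes G: "G = square_hung_star a b c d e P" and d: "distinct [a, b, c, d, e]"
    and disj: "{a, b, c, d, e} \<inter> P = {}" and p: "p \<in> P"
    and pos: "s a b * s b c * s c d * s d a = 1"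
  shows "nullity G \<sigma> = card (verts G) - 4"
proof (rule nullity_four)
  let ?K = "{p, e, a, b}"
  have ed: "edges G = cycle_edges [a, b, c, d] \<union> star_edges e (insert a P)"
    by (simp add: G square_hung_star_def)
  have E: "E u v \<longleftrightarrow> {u, v} = {a, b} \<or> {u, v} = {b, c} \<or> {u, v} = {c, d} \<or> {u, v} = {d, a} \<or>
      u = e \<and> (v = a \<or> v \<in> P) \<or> v = e \<and> (u = a \<or> u \<in> P)" for u v
    by (simp only: E_def ed cycle_edges_4 Un_iff in_star_edges insert_iff empty_iff disj_assoc simp_thms)
  have Ep: "E v w \<longleftrightarrow> w = e" if "v \<in> P" for v w using d disj that by (auto simp: E doubleton_eq_iff)
  have Ea: "E a w \<longleftrightarrow> w = b \<or> w = d \<or> w = e" for w using d disj by (auto simp: E doubleton_eq_iff)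
  have Eb: "E b w \<longleftrightarrow> w = a \<or> w = c" for w using d disj by (auto simp: E doubleton_eq_iff)
  have Ec: "E c w \<longleftrightarrow> w = b \<or> w = d" for w using d disj by (auto simp: E doubleton_eq_iff)
  have Ed: "E d w \<longleftrightarrow> w = a \<or> w = c" for w using d disj by (auto simp: E doubleton_eq_iff)
  have sg: "s a b \<in> {1, -1}" "s b c \<in> {1, -1}" "s c d \<in> {1, -1}" "s d a \<in> {1, -1}" "s p e \<in> {1, -1}"
    by (rule s_sign, simp add: Ep[OF p] Ea Eb Ec Ed)+
  show "?K \<subseteq> verts G" using p by (auto simp: G square_hung_star_def)
  have pn: "p \<notin> {e, a, b}" using p disj by blast
  then show "card ?K = 4" using d by auto
  have Eab: "E a b" by (simp add: E)
  show "nonsingular_on s ?K"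
    by (rule nonsingular_on_two_pairs[OF _ Eab]) (use d p disj Ep[OF p] in auto)
  fix v assume "v \<in> verts G - ?K"
  then consider "v \<in> P" | "v = c" | "v = d" by (auto simp: G square_hung_star_def)
  then show "row_spanned s (verts G) ?K v"
  proof cases
    case 1
    show ?thesis by (rule row_spanned_leaf[OF _ _ Ep[OF p]]) (use Ep[OF 1] in auto)
  next
    case 2
    show ?thesis
    proof (rule row_spanned_two)
      fix w
      show "s v w = (s c b * s a b) * s a w + (- (s c b * s a b) * s a e * s p e) * s p w"
        unfolding 2
        using sg pos s_commute[of c b] s_commute[of a d] Ea[of w] Ec[of w] Ep[OF p, of w] d
        by (cases "w = b"; cases "w = d"; cases "w = e") (auto simp: s_eq_0)
    qed auto
  next
    case 3
    show ?thesis
    proof (rule row_spanned_two)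
      fix w
      show "s v w = (s d a * s b a) * s b w + 0 * s b w"
        unfolding 3
        using sg pos s_commute[of b a] s_commute[of d c] Eb[of w] Ed[of w] d
        by (cases "w = a"; cases "w = c") (auto simp: s_eq_0)
    qed auto
  qed
qed

lemma nullity_positive_square:
  assumes V: "verts G = {a, b, c, d}" and ed: "edges G = cycle_edges [a, b, c, d]"
    and d: "distinct [a, b, c, d]" and pos: "s a b * s b c * s c d * s d a = 1"
  shows "nullity G \<sigma> = 2"
proof -
  have E: "E u v \<longleftrightarrow> {u, v} = {a, b} \<or> {u, v} = {b, c} \<or> {u, v} = {c, d} \<or> {u, v} = {d, a}" for u v
    by (simp add: E_def ed cycle_edges_4)
  have Ea: "E a w \<longleftrightarrow> w = b \<or> w = d" for w using d by (auto simp: E doubleton_eq_iff)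
  have Eb: "E b w \<longleftrightarrow> w = a \<or> w = c" for w using d by (auto simp: E doubleton_eq_iff)
  have Ec: "E c w \<longleftrightarrow> w = b \<or> w = d" for w using d by (auto simp: E doubleton_eq_iff)
  have Ed: "E d w \<longleftrightarrow> w = a \<or> w = c" for w using d by (auto simp: E doubleton_eq_iff)
  have sg: "s a b \<in> {1, -1}" "s b c \<in> {1, -1}" "s c d \<in> {1, -1}" "s d a \<in> {1, -1}"
    by (rule s_sign, simp add: Ea Eb Ec Ed)+
  have "nullity G \<sigma> = card (verts G) - card {a, b}"
  proof (rule nullity_spanned[OF finite_verts])
    show "{a, b} \<subseteq> verts G" by (simp add: V)
    show "nonsingular_on s {a, b}"
      by (intro nonsingular_on_insert_pair nonsingular_on_empty) (use d Ea in auto)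
    fix v assume "v \<in> verts G - {a, b}"
    then consider "v = c" | "v = d" by (auto simp: V)
    then show "row_spanned s (verts G) {a, b} v"
    proof cases
      case 1
      show ?thesis
      proof (rule row_spanned_two)
        fix w
        show "s v w = (s c b * s a b) * s a w + 0 * s a w"
          unfolding 1
          using sg pos s_commute[of c b] s_commute[of a d] Ea[of w] Ec[of w] d
          by (cases "w = b"; cases "w = d") (auto simp: s_eq_0)
      qed auto
    next
      case 2
      show ?thesis
      proof (rule row_spanned_two)
        fix w
        show "s v w = (s d a * s b a) * s b w + 0 * s b w"
          unfolding 2
          using sg pos s_commute[of b a] s_commute[of d c] Eb[of w] Ed[of w] d
          by (cases "w = a"; cases "w = c") (auto simp: s_eq_0)
      qed auto
    qed
  qed
  then show ?thesis using d by (simp add: V)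
qed

lemma nullity_negative_square:
  assumes V: "verts G = {a, b, c, d}" and ed: "edges G = cycle_edges [a, b, c, d]"
    and d: "distinct [a, b, c, d]" and neg: "s a b * s b c * s c d * s d a = -1"
  shows "nullity G \<sigma> = card (verts G) - 4"
proof (rule nullity_four)
  have E: "E u v \<longleftrightarrow> {u, v} = {a, b} \<or> {u, v} = {b, c} \<or> {u, v} = {c, d} \<or> {u, v} = {d, a}" for u v
    by (simp add: E_def ed cycle_edges_4)
  show "nonsingular_on s {a, b, c, d}"
    by (rule nonsingular_on_negative_square) (use d neg in \<open>auto simp: E doubleton_eq_iff\<close>)
qed (use V d in auto)

text \<open>
  The rows of \<open>a\<close>, \<open>c\<close> and \<open>e\<close> live on the columns \<open>b\<close>, \<open>d\<close>, \<open>f\<close> and are dependent for a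
  negative hexagon, and the same holds with the two classes exchanged. A path on four vertices
  contains two rows of each class.
\<close>

lemma nullity_negative_hexagon:
  assumes V: "verts G = {a, b, c, d, e, f}" and ed: "edges G = cycle_edges [a, b, c, d, e, f]"
    and d: "distinct [a, b, c, d, e, f]" and neg: "s a b * s b c * s c d * s d e * s e f * s f a = -1"
  shows "nullity G \<sigma> = card (verts G) - 4"
proof (rule nullity_four)
  let ?K = "{a, b, c, d}"
  have E: "E u v \<longleftrightarrow> {u, v} = {a, b} \<or> {u, v} = {b, c} \<or> {u, v} = {c, d} \<or> {u, v} = {d, e} \<or>
      {u, v} = {e, f} \<or> {u, v} = {f, a}" for u v
    by (simp add: E_def ed cycle_edges_6)
  have Ea: "E a w \<longleftrightarrow> w = b \<or> w = f" for w using d by (auto simp: E doubleton_eq_iff)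
  have Eb: "E b w \<longleftrightarrow> w = a \<or> w = c" for w using d by (auto simp: E doubleton_eq_iff)
  have Ec: "E c w \<longleftrightarrow> w = b \<or> w = d" for w using d by (auto simp: E doubleton_eq_iff)
  have Ed: "E d w \<longleftrightarrow> w = c \<or> w = e" for w using d by (auto simp: E doubleton_eq_iff)
  have Ee: "E e w \<longleftrightarrow> w = d \<or> w = f" for w using d by (auto simp: E doubleton_eq_iff)
  have Ef: "E f w \<longleftrightarrow> w = e \<or> w = a" for w using d by (auto simp: E doubleton_eq_iff)
  have sg: "s a b \<in> {1, -1}" "s b c \<in> {1, -1}" "s c d \<in> {1, -1}" "s d e \<in> {1, -1}"
    "s e f \<in> {1, -1}" "s f a \<in> {1, -1}"
    by (rule s_sign, simp add: Ea Eb Ec Ed Ee Ef)+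
  have h: "s e f * s f a * s a b + s d e * s c d * s b c = 0"
    "s f a * s a b * s b c + s e f * s d e * s c d = 0"
    using sg neg by (auto simp: mult_ac)
  show "?K \<subseteq> verts G" "card ?K = 4" using d by (auto simp: V)
  show "nonsingular_on s ?K"
    by (rule nonsingular_on_two_pairs) (use d in \<open>auto simp: E doubleton_eq_iff\<close>)
  fix v assume "v \<in> verts G - ?K"
  then consider "v = e" | "v = f" by (auto simp: V)
  then show "row_spanned s (verts G) ?K v"
  proof cases
    case 1
    show ?thesis
    proof (rule row_spanned_two)
      fix w
      show "s v w = (s e f * s f a) * s a w + (s d e * s c d) * s c w"
        unfolding 1 using h(1) d
        by (cases "w = b"; cases "w = d"; cases "w = f")
          (auto simp: s_eq_0 s_square_cancel Ea Ec Ee Ef s_commute[of e d] s_commute[of a f] s_commute[of c b])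
    qed auto
  next
    case 2
    show ?thesis
    proof (rule row_spanned_two)
      fix w
      show "s v w = (s f a * s a b) * s b w + (s e f * s d e) * s d w"
        unfolding 2 using h(2) d
        by (cases "w = a"; cases "w = c"; cases "w = e")
          (auto simp: s_eq_0 s_square_cancel Ea Eb Ed Ef s_commute[of f e] s_commute[of b a] s_commute[of d c])
    qed auto
  qed
qed

end

section \<open>Cycles of a unicyclic graph\<close>

context signed
begin

text \<open>
  Cycles as vertex sequences: in contrast to edge sets, a sequence of known length can be written
  out, and its edges become adjacencies.
\<close>

definition cycle_list :: "'a list \<Rightarrow> bool" where
  "cycle_list ws \<longleftrightarrow> distinct ws \<and> 3 \<le> length ws \<and> cycle_edges ws \<subseteq> edges G"

lemma cycle_list_3: "cycle_list [a, b, c] \<longleftrightarrow> distinct [a, b, c] \<and> E a b \<and> E b c \<and> E c a"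
  by (simp add: cycle_list_def cycle_edges_3 E_def)

lemma cycle_list_4: "cycle_list [a, b, c, d] \<longleftrightarrow> distinct [a, b, c, d] \<and> E a b \<and> E b c \<and> E c d \<and> E d a"
  by (simp add: cycle_list_def cycle_edges_4 E_def)

lemma cycle_list_5: "cycle_list [a, b, c, d, e] \<longleftrightarrow>
    distinct [a, b, c, d, e] \<and> E a b \<and> E b c \<and> E c d \<and> E d e \<and> E e a"
  by (simp add: cycle_list_def cycle_edges_5 E_def)

lemma cycle_list_6: "cycle_list [a, b, c, d, e, f] \<longleftrightarrow>
    distinct [a, b, c, d, e, f] \<and> E a b \<and> E b c \<and> E c d \<and> E d e \<and> E e f \<and> E f a"
  by (simp add: cycle_list_def cycle_edges_6 E_def)

lemma cycle_list_nth: "cycle_list cs \<Longrightarrow> Suc i < length cs \<Longrightarrow> E (cs ! i) (cs ! Suc i)"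
  unfolding cycle_list_def E_def cycle_edges_def by (auto 0 3 intro!: exI[of _ i])

lemma cycle_list_verts: "cycle_list cs \<Longrightarrow> set cs \<subseteq> verts G"
  using simple Union_cycle_edges[of cs] unfolding cycle_list_def simple_graph_def by blast

lemma edges_eqI:
  assumes "\<And>u v. E u v \<longleftrightarrow> {u, v} \<in> X" "\<And>e. e \<in> X \<Longrightarrow> \<exists>u v. e = {u, v}"
  shows "edges G = X"
proof -
  have pair: "\<exists>u v. e = {u, v}" if "e \<in> edges G" for e
  proof -
    have "card e = 2" using simple that by (simp add: simple_graph_def)
    then show ?thesis by (auto simp: card_2_iff)
  qed
  show ?thesis
  proof (rule Set.set_eqI)
    fix e
    show "e \<in> edges G \<longleftrightarrow> e \<in> X"
    proof (cases "\<exists>u v. e = {u, v}")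
      case True
      then obtain u v where "e = {u, v}" by blast
      then show ?thesis using assms(1)[of u v] by (simp add: E_def)
    next
      case False
      then show ?thesis using pair[of e] assms(2)[of e] by argo
    qed
  qed
qed

lemma prod_square:
  assumes "cycle_list [a, b, c, d]"
  shows "(\<Prod>e\<in>cycle_edges [a, b, c, d]. \<sigma> e) = s a b * s b c * s c d * s d a"
proof -
  have "E a b" "E b c" "E c d" "E d a" "distinct [a, b, c, d]" "distinct [d, c, b, a]"
    using assms by (auto simp: cycle_list_4)
  then show ?thesis by (simp add: cycle_edges_4 doubleton_eq_iff s_eq)
qed

lemma prod_hexagon:
  assumes "cycle_list [a, b, c, d, e, f]"
  shows "(\<Prod>e\<in>cycle_edges [a, b, c, d, e, f]. \<sigma> e) = s a b * s b c * s c d * s d e * s e f * s f a"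
proof -
  have "E a b" "E b c" "E c d" "E d e" "E e f" "E f a" "distinct [a, b, c, d, e, f]" "distinct [f, e, d, c, b, a]"
    using assms by (auto simp: cycle_list_6)
  then show ?thesis by (simp add: cycle_edges_6 doubleton_eq_iff s_eq)
qed

end

locale unicyclic_signed = signed +
  assumes unicyclic: "unicyclic G"
begin

lemma ex_cyc: "\<exists>cs. cycle_list cs"
  using unicyclic unfolding unicyclic_def is_cycle_def cycle_list_def by blast

lemma cycle_list_cycle_edges_unique: "cycle_list vs \<Longrightarrow> cycle_list ws \<Longrightarrow> cycle_edges vs = cycle_edges ws"
  using unicyclic unfolding unicyclic_def is_cycle_def cycle_list_def by blast

lemma cycle_list_unique:
  assumes "cycle_list vs" "cycle_list ws"
  shows "set vs = set ws" "length vs = length ws"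
proof -
  show "set vs = set ws"
    using cycle_list_cycle_edges_unique[OF assms] Union_cycle_edges by metis
  then show "length vs = length ws" using assms distinct_card unfolding cycle_list_def by metis
qed

lemma balanced_iff:
  assumes "cycle_list cs"
  shows "balanced G \<sigma> \<longleftrightarrow> (\<Prod>e\<in>cycle_edges cs. \<sigma> e) = 1"
proof -
  have "is_cycle G C \<longleftrightarrow> C = cycle_edges cs" for C
    using cycle_list_cycle_edges_unique[OF assms] assms unfolding is_cycle_def cycle_list_def by blast
  then show ?thesis by (simp add: balanced_def)
qed

text \<open>
  The form in which connectedness is used to list all vertices.
\<close>

lemma verts_subset_of_closed:
  assumes u: "u \<in> S" "u \<in> verts G" and closed: "\<And>u v. u \<in> S \<Longrightarrow> E u v \<Longrightarrow> v \<in> S"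
  shows "verts G \<subseteq> S"
proof
  fix v assume "v \<in> verts G"
  then have "(u, v) \<in> {(x, y). {x, y} \<in> edges G}\<^sup>*"
    using unicyclic u unfolding unicyclic_def connected_graph_def by blast
  then show "v \<in> S" by (induction rule: rtrancl_induct) (use u closed in \<open>auto simp: E_def\<close>)
qed

end

section \<open>Unicyclic signed graphs of rank four\<close>

locale unicyclic_rank_four = unicyclic_signed +
  assumes order_ge: "4 \<le> card (verts G)" and nullity: "nullity G \<sigma> = card (verts G) - 4"
begin

lemma nonsingular_card_le:
  assumes "K \<subseteq> verts G" "nonsingular_on s K"
  shows "card K \<le> 4"
proof -
  have "card K \<le> card (verts G)" using assms finite_verts by (intro card_mono)
  then show ?thesis
    using nullity_le_of_nonsingular[OF finite_verts assms] nullity order_ge by linarith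
qed

lemma no_three_pairs:
  assumes "E u1 w1" "E u2 w2" "E u3 w3" "distinct [u1, w1, u2, w2, u3, w3]"
    "\<not> E u1 u2" "\<not> E u1 w2" "\<not> E u1 u3" "\<not> E u1 w3" "\<not> E u2 u3" "\<not> E u2 w3"
  shows False
proof -
  have "card {u1, w1, u2, w2, u3, w3} \<le> 4"
    by (rule nonsingular_card_le)
      (use nonsingular_on_three_pairs[OF assms] assms(1-3) E_verts in auto)
  then show False using assms(4) by simp
qed

text \<open>
  Six consecutive vertices of a longer cycle form an induced path, since a chord would close a
  cycle on at most six vertices. A path on six vertices consists of three pairs.
\<close>

lemma cycle_list_length_le: assumes cs: "cycle_list cs" shows "length cs \<le> 6"
proof (rule ccontr)
  assume l: "\<not> length cs \<le> 6"
  then have "length (take 6 cs) = 6" by simp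
  then obtain a b c d e f where t: "take 6 cs = [a, b, c, d, e, f]" unfolding length_6 by blast
  define rest where "rest = drop 6 cs"
  have ws: "cs = a # b # c # d # e # f # rest"
    using append_take_drop_id[of 6 cs] unfolding t rest_def[symmetric] by simp
  have len: "length cs > 6" and dist: "distinct [a, b, c, d, e, f]"
    using l cs by (auto simp: cycle_list_def ws)
  have E: "E a b" "E b c" "E c d" "E d e" "E e f"
    using cycle_list_nth[OF cs, of 0] cycle_list_nth[OF cs, of 1] cycle_list_nth[OF cs, of 2] cycle_list_nth[OF cs, of 3]
      cycle_list_nth[OF cs, of 4] len by (simp_all add: ws numeral_eq_Suc)
  have short: "\<not> cycle_list vs" if "length vs \<le> 6" for vs
    using cycle_list_unique(2)[OF cs, of vs] len that by auto
  have nE: "\<not> E a c" "\<not> E a d" "\<not> E a e" "\<not> E a f" "\<not> E c e" "\<not> E c f"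
    using short[of "[a, b, c]"] short[of "[a, b, c, d]"] short[of "[a, b, c, d, e]"]
      short[of "[a, b, c, d, e, f]"] short[of "[c, d, e]"] short[of "[c, d, e, f]"]
      E dist E_commute[of c a] E_commute[of d a] E_commute[of e a] E_commute[of f a]
      E_commute[of e c] E_commute[of f c]
    by (simp_all add: cycle_list_3 cycle_list_4 cycle_list_5 cycle_list_6)
  show False by (rule no_three_pairs[OF E(1,3,5)]) (use dist nE in auto)
qed

lemma cycle_list_length_neq_5: assumes cs: "cycle_list cs" shows "length cs \<noteq> 5"
proof
  assume l: "length cs = 5"
  then obtain a b c d e where ws: "cs = [a, b, c, d, e]" unfolding length_5 by blast
  have E: "E a b" "E b c" "E c d" "E d e" "E e a" and dist: "distinct [a, b, c, d, e]"
    using cs unfolding ws cycle_list_5 by auto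
  have short: "\<not> cycle_list vs" if "length vs = 3" for vs
    using cycle_list_unique(2)[OF cs, of vs] l that by auto
  have nE: "\<not> E a c" "\<not> E a d" "\<not> E b d" "\<not> E b e" "\<not> E c e"
    using short[of "[a, b, c]"] short[of "[a, d, e]"] short[of "[b, c, d]"]
      short[of "[b, e, a]"] short[of "[c, d, e]"]
      E dist E_commute[of c a] E_commute[of d b] E_commute[of e c]
    by (auto simp: cycle_list_3)
  have "card {a, b, c, d, e} \<le> 4"
    by (rule nonsingular_card_le)
      (use nonsingular_on_pentagon[OF E dist nE] cycle_list_verts[OF cs] ws in auto)
  then show False using dist by simp
qed

section \<open>The hexagon\<close>

lemma hexagon_rotate: "cycle_list [a, b, c, d, e, f] \<Longrightarrow> cycle_list [b, c, d, e, f, a]"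
  by (auto simp: cycle_list_6)

lemma hexagon_chords:
  assumes cs: "cycle_list [a, b, c, d, e, f]"
  shows "\<not> E a c" "\<not> E a d" "\<not> E c a" "\<not> E d a"
  using cycle_list_unique(2)[OF cs, of "[a, b, c]"] cycle_list_unique(2)[OF cs, of "[a, b, c, d]"]
    cs E_commute[of c a] E_commute[of d a]
  by (auto simp: cycle_list_3 cycle_list_4 cycle_list_6)

text \<open>
  Besides the pair of \<open>p\<close> and \<open>a\<close>, the path \<open>c\<close>, \<open>d\<close>, \<open>e\<close>, \<open>f\<close> provides two more pairs.
\<close>

lemma hexagon_no_attached:
  assumes cs: "cycle_list [a, b, c, d, e, f]" and p: "p \<notin> {a, b, c, d, e, f}"
  shows "\<not> E p a"
proof
  assume pa: "E p a"
  have E: "E a b" "E b c" "E c d" "E d e" "E e f" "E f a" and dist: "distinct [a, b, c, d, e, f]"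
    using cs unfolding cycle_list_6 by auto
  have outside: "\<not> cycle_list vs" if "p \<in> set vs" for vs
    using cycle_list_unique(1)[OF cs, of vs] p that by auto
  have nE: "\<not> E p c" "\<not> E p d" "\<not> E p e" "\<not> E p f"
    using outside[of "[p, a, b, c]"] outside[of "[p, a, b, c, d]"] outside[of "[p, a, f, e]"]
      outside[of "[p, a, f]"] E dist p pa
      E_commute[of c p] E_commute[of d p] E_commute[of e p] E_commute[of f p]
      E_commute[of a f] E_commute[of f e]
    by (auto simp: cycle_list_3 cycle_list_4 cycle_list_5)
  note rot = hexagon_rotate[OF hexagon_rotate[OF cs]]
  show False
    by (rule no_three_pairs[OF pa E(3,5)])
      (use dist nE p hexagon_chords[OF rot] in auto)
qed

lemma hexagon_case:
  assumes cs: "cycle_list [a, b, c, d, e, f]"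
  shows "graph_iso G (cycle_graph 6) \<and> \<not> balanced G \<sigma>"
proof -
  let ?S = "{a, b, c, d, e, f}"
  have E: "E a b" "E b c" "E c d" "E d e" "E e f" "E f a" and dist: "distinct [a, b, c, d, e, f]"
    using cs unfolding cycle_list_6 by auto
  note r1 = hexagon_rotate[OF cs] note r2 = hexagon_rotate[OF r1] note r3 = hexagon_rotate[OF r2]
  note r4 = hexagon_rotate[OF r3] note r5 = hexagon_rotate[OF r4]
  note chords = hexagon_chords[OF cs] hexagon_chords[OF r1] hexagon_chords[OF r2]
    hexagon_chords[OF r3] hexagon_chords[OF r4] hexagon_chords[OF r5]
  have SV: "?S \<subseteq> verts G" using cycle_list_verts[OF cs] by simp
  have out: "\<not> E u p" if "u \<in> ?S" "p \<notin> ?S" for u p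
    using that hexagon_no_attached[OF cs, of p] hexagon_no_attached[OF r1, of p]
      hexagon_no_attached[OF r2, of p] hexagon_no_attached[OF r3, of p]
      hexagon_no_attached[OF r4, of p] hexagon_no_attached[OF r5, of p] E_commute[of u p]
    by auto
  have "verts G \<subseteq> ?S" by (rule verts_subset_of_closed[of a]) (use SV out in auto)
  then have V: "verts G = ?S" using SV by blast
  have "edges G = cycle_edges [a, b, c, d, e, f]"
  proof (rule edges_eqI)
    fix u v
    show "E u v \<longleftrightarrow> {u, v} \<in> cycle_edges [a, b, c, d, e, f]"
    proof
      assume uv: "E u v"
      then have "u \<in> ?S" "v \<in> ?S" using E_verts V by auto
      then show "{u, v} \<in> cycle_edges [a, b, c, d, e, f]"
        unfolding cycle_edges_6 using uv chords
        by (elim insertE emptyE) (simp_all add: doubleton_eq_iff)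
    next
      assume "{u, v} \<in> cycle_edges [a, b, c, d, e, f]"
      then show "E u v" using E by (auto simp: cycle_edges_6 E_def)
    qed
  qed (auto simp: cycle_edges_6)
  then have G: "G = (set [a, b, c, d, e, f], cycle_edges [a, b, c, d, e, f])"
    using V by (simp add: prod_eq_iff)
  then have "\<exists>xs. length xs = 6 \<and> distinct xs \<and> G = (set xs, cycle_edges xs)"
    using dist by (intro exI[of _ "[a, b, c, d, e, f]"]) simp
  then have "graph_iso G (cycle_graph 6)"
    by (subst graph_iso_cycle_iff[OF simple]) simp_all
  moreover have "\<not> balanced G \<sigma>"
  proof
    assume "balanced G \<sigma>"
    then have "s a b * s b c * s c d * s d e * s e f * s f a = 1"
      using balanced_iff[OF cs] prod_hexagon[OF cs] by simp
    then have "nonsingular_on s ?S"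
      by (intro nonsingular_on_positive_hexagon) (use E dist chords in \<open>auto simp: E_commute\<close>)
    then have "card ?S \<le> 4" by (intro nonsingular_card_le SV)
    then show False using dist by simp
  qed
  ultimately show ?thesis ..
qed

section \<open>The triangle\<close>

lemma triangle_attached_once:
  assumes cs: "cycle_list [a, b, c]" and p: "p \<notin> {a, b, c}" and pa: "E p a"
  shows "\<not> E p b" "\<not> E p c"
proof -
  have E: "E a b" "E b c" "E c a" and dist: "distinct [a, b, c]"
    using cs unfolding cycle_list_3 by auto
  have outside: "\<not> cycle_list vs" if "p \<in> set vs" for vs
    using cycle_list_unique(1)[OF cs, of vs] p that by auto
  show "\<not> E p b" "\<not> E p c"
    using outside[of "[p, a, b]"] outside[of "[p, a, c]"] E dist p pa
      E_commute[of b p] E_commute[of c p] E_commute[of a c]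
    by (auto simp: cycle_list_3)
qed

lemma triangle_attached_independent:
  assumes cs: "cycle_list [a, b, c]" and p: "p \<notin> {a, b, c}" and pa: "E p a"
    and q: "q \<notin> {a, b, c}" "E q x" "x \<in> {a, b, c}"
  shows "\<not> E p q"
proof
  assume pq: "E p q"
  have E: "E a b" "E b c" "E c a" and dist: "distinct [a, b, c]"
    using cs unfolding cycle_list_3 by auto
  have outside: "\<not> cycle_list vs" if "p \<in> set vs" for vs
    using cycle_list_unique(1)[OF cs, of vs] p that by auto
  show False
    using outside[of "[p, a, q]"] outside[of "[p, a, b, q]"] outside[of "[p, a, c, q]"] E dist p pa q pq
      E_commute[of q p] E_commute[of a q] E_commute[of b q] E_commute[of c q] E_commute[of a c]
    by (auto simp: cycle_list_3 cycle_list_4)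
qed

text \<open>
  A vertex at distance two from the triangle, with its neighbour towards the triangle, extends the
  triangle to a nonsingular set of five vertices. So every vertex is attached to the triangle,
  and if all three corners had one, these would form three pairs with their corners.
\<close>

lemma triangle_case:
  assumes cs: "cycle_list [a, b, c]"
  shows "\<exists>r s. r \<ge> s \<and> r + s \<ge> 1 \<and> graph_iso G (U1 r s)"
proof -
  \<comment> \<open>The corner without attached vertices is named \<open>c\<close>, and the larger star is at \<open>a\<close>.\<close>
  have main: "\<exists>r s. r \<ge> s \<and> r + s \<ge> 1 \<and> graph_iso G (U1 r s)"
    if cs: "cycle_list [a, b, c]" and noc: "\<And>p. p \<notin> {a, b, c} \<Longrightarrow> \<not> E p c"
      and ge: "card {p. p \<notin> {a, b, c} \<and> E p a} \<ge> card {p. p \<notin> {a, b, c} \<and> E p b}" for a b c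
  proof -
    let ?S = "{a, b, c}"
    define P Q where "P = {p. p \<notin> ?S \<and> E p a}" and "Q = {p. p \<notin> ?S \<and> E p b}"
    have E: "E a b" "E b c" "E c a" and dist: "distinct [a, b, c]"
      using cs unfolding cycle_list_3 by auto
    have cs': "cycle_list [b, c, a]" "cycle_list [b, a, c]" using cs E_commute by (auto simp: cycle_list_3)
    have SV: "?S \<subseteq> verts G" using cycle_list_verts[OF cs] by simp
    have PV: "P \<subseteq> verts G" "Q \<subseteq> verts G" using E_verts by (auto simp: P_def Q_def)
    then have fin: "finite P" "finite Q" using finite_verts finite_subset by blast+
    have PQ: "P \<inter> Q = {}" using triangle_attached_once[OF cs] by (auto simp: P_def Q_def)
    have far: False if uv: "E u v" "u \<in> P \<union> Q" "v \<notin> ?S \<union> P \<union> Q" for u v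
    proof -
      have nE: "\<not> E v x" if "x \<in> ?S" for x
        using uv(3) noc that by (auto simp: P_def Q_def)
      have notin: "u \<notin> ?S" "v \<notin> ?S" "v \<noteq> u" using uv by (auto simp: P_def Q_def)
      have vu: "E v u" using uv(1) E_commute by blast
      have "nonsingular_on s (insert v (insert u ?S))"
        by (rule nonsingular_on_insert_pair[OF nonsingular_on_triangle[OF E]])
          (use notin vu nE in auto)
      then have "card (insert v (insert u ?S)) \<le> 4"
        by (rule nonsingular_card_le[rotated]) (use SV E_verts[OF uv(1)] in simp)
      then show False using notin dist by simp
    qed
    have near: "v \<in> ?S \<union> P \<union> Q" if "u \<in> ?S" "E u v" for u v
      using that noc[of v] E_commute[of u v] by (auto simp: P_def Q_def)
    have "verts G \<subseteq> ?S \<union> P \<union> Q"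
      by (rule verts_subset_of_closed[of a]) (use SV near far in blast)+
    then have V: "verts G = ?S \<union> P \<union> Q" using SV PV by blast
    have indep: "\<not> E u v" if "u \<in> P \<union> Q" "v \<in> P \<union> Q" for u v
      using that triangle_attached_independent[OF cs, of u v] triangle_attached_independent[OF cs'(1), of u v]
      by (auto simp: P_def Q_def)
    have out: "u = a \<and> v \<in> P \<or> u = b \<and> v \<in> Q" if "u \<in> ?S" "v \<notin> ?S" "E v u" for u v
      using that noc[of v] by (auto simp: P_def Q_def)
    have "edges G = cycle_edges [a, b, c] \<union> star_edges a P \<union> star_edges b Q"
    proof (rule edges_eqI)
      fix u v
      show "E u v \<longleftrightarrow> {u, v} \<in> cycle_edges [a, b, c] \<union> star_edges a P \<union> star_edges b Q" (is "_ \<longleftrightarrow> ?R")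
      proof
        assume uv: "E u v"
        then have vu: "E v u" using E_commute by blast
        consider "u \<in> ?S" "v \<in> ?S" | "u \<in> ?S" "v \<notin> ?S" | "u \<notin> ?S" "v \<in> ?S" | "u \<notin> ?S" "v \<notin> ?S" by blast
        then show ?R
        proof cases
          case 1
          then have "{u, v} \<in> cycle_edges [a, b, c]"
            unfolding cycle_edges_3 using uv
            by (elim insertE emptyE) (simp_all add: doubleton_eq_iff)
          then show ?thesis by blast
        next
          case 2
          show ?thesis using out[OF 2 vu] by (simp add: in_star_edges) blast
        next
          case 3
          show ?thesis using out[OF 3(2,1) uv] by (simp add: in_star_edges) blast
        next
          case 4
          then show ?thesis using uv indep[of u v] E_verts[OF uv] V by blast
        qed
      next
        assume ?R
        then consider "{u, v} \<in> cycle_edges [a, b, c]" | "{u, v} \<in> star_edges a P" | "{u, v} \<in> star_edges b Q"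
          by blast
        then show "E u v"
        proof cases
          case 1
          then show ?thesis using E by (auto simp: cycle_edges_3 E_def)
        qed (use E_commute[of u v] in \<open>auto simp: in_star_edges P_def Q_def\<close>)
      qed
    qed (auto simp: cycle_edges_3 star_edges_def)
    then have G: "G = triangle_stars a b c P Q" using V by (simp add: prod_eq_iff triangle_stars_def)
    have "card (verts G) \<le> card ?S + card P + card Q"
      unfolding V by (metis card_Un_le add_le_mono1 le_trans)
    then have "card P + card Q \<ge> 1" using order_ge dist by simp
    moreover have "graph_iso G (U1 (card P) (card Q))"
      unfolding graph_iso_U1_iff[OF simple]
      by (rule exI[of _ a], rule exI[of _ b], rule exI[of _ c], rule exI[of _ P], rule exI[of _ Q])
        (use G PQ fin dist in \<open>auto simp: P_def Q_def\<close>)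
    ultimately show ?thesis using ge by (auto simp: P_def Q_def)
  qed
  have main2: ?thesis if cs: "cycle_list [a, b, c]" and noc: "\<And>p. p \<notin> {a, b, c} \<Longrightarrow> \<not> E p c" for a b c
  proof -
    have cs': "cycle_list [b, a, c]" using cs E_commute by (auto simp: cycle_list_3)
    have S: "{b, a, c} = {a, b, c}" by blast
    show ?thesis
      using main[OF cs noc] main[OF cs', unfolded S, OF noc] linear by blast
  qed
  have E: "E a b" "E b c" "E c a" and dist: "distinct [a, b, c]"
    using cs unfolding cycle_list_3 by auto
  have cs': "cycle_list [b, c, a]" "cycle_list [c, a, b]" using cs by (auto simp: cycle_list_3)
  have S: "{b, c, a} = {a, b, c}" "{c, a, b} = {a, b, c}" by blast+
  have "\<exists>x\<in>{a, b, c}. \<forall>p. p \<notin> {a, b, c} \<longrightarrow> \<not> E p x"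
  proof (rule ccontr)
    assume none: "\<not> ?thesis"
    have ex: "\<exists>p. p \<notin> {a, b, c} \<and> E p x" if "x \<in> {a, b, c}" for x
      using none that by (meson bexI)
    obtain p q r where pqr: "p \<notin> {a, b, c}" "E p a" "q \<notin> {a, b, c}" "E q b" "r \<notin> {a, b, c}" "E r c"
      using ex[of a] ex[of b] ex[of c] by (metis insertI1 insertI2)
    note p = triangle_attached_once[OF cs pqr(1,2)]
      triangle_attached_independent[OF cs pqr(1,2)]
    note q = triangle_attached_once[OF cs'(1), unfolded S, OF pqr(3,4)]
      triangle_attached_independent[OF cs'(1), unfolded S, OF pqr(3,4)]
    show False
      by (rule no_three_pairs[OF pqr(2,4,6)])
        (use p q pqr dist triangle_attached_once[OF cs] in auto)
  qed
  then consider "\<And>p. p \<notin> {a, b, c} \<Longrightarrow> \<not> E p a" | "\<And>p. p \<notin> {a, b, c} \<Longrightarrow> \<not> E p b"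
    | "\<And>p. p \<notin> {a, b, c} \<Longrightarrow> \<not> E p c" by blast
  then show ?thesis
    using main2[OF cs] main2[OF cs'(1), unfolded S] main2[OF cs'(2), unfolded S] by cases blast+
qed

section \<open>The square\<close>

lemma square_rotate: "cycle_list [a, b, c, d] \<Longrightarrow> cycle_list [b, c, d, a]"
  by (auto simp: cycle_list_4)

lemma square_reflect: "cycle_list [a, b, c, d] \<Longrightarrow> cycle_list [a, d, c, b]"
  using E_commute by (auto simp: cycle_list_4)

lemma square_chord:
  assumes cs: "cycle_list [a, b, c, d]" shows "\<not> E a c" "\<not> E c a"
  using cycle_list_unique(2)[OF cs, of "[a, b, c]"] cs E_commute[of c a]
  by (auto simp: cycle_list_3 cycle_list_4)

lemma square_attached_once:
  assumes cs: "cycle_list [a, b, c, d]" and p: "p \<notin> {a, b, c, d}" and pa: "E p a"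
  shows "\<not> E p b" "\<not> E p c" "\<not> E p d"
proof -
  have E: "E a b" "E b c" "E c d" "E d a" and dist: "distinct [a, b, c, d]"
    using cs unfolding cycle_list_4 by auto
  have outside: "\<not> cycle_list vs" if "p \<in> set vs" for vs
    using cycle_list_unique(1)[OF cs, of vs] p that by auto
  show "\<not> E p b" "\<not> E p c" "\<not> E p d"
    using outside[of "[p, a, b]"] outside[of "[p, a, b, c]"] outside[of "[p, a, d]"] E dist p pa
      E_commute[of b p] E_commute[of c p] E_commute[of d p] E_commute[of a d]
    by (auto simp: cycle_list_3 cycle_list_4)
qed

text \<open>
  Two vertices attached to the square are joined by a path through it. An edge between them, or a
  common neighbour outside, would close a second cycle.
\<close>

lemma square_attached_paths:
  assumes cs: "cycle_list [a, b, c, d]" and p: "p \<notin> {a, b, c, d}" and pa: "E p a"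
    and q: "q \<notin> {a, b, c, d}" "q \<noteq> p" "E q x" "x \<in> {a, b, c, d}"
  shows "\<not> E p q" and "y \<notin> {a, b, c, d} \<Longrightarrow> E y p \<Longrightarrow> \<not> E y q"
proof -
  have E: "E a b" "E b c" "E c d" "E d a" "E a d" and dist: "distinct [a, b, c, d]"
    using cs E_commute[of a d] unfolding cycle_list_4 by auto
  have outside: "\<not> cycle_list vs" if "p \<in> set vs" for vs
    using cycle_list_unique(1)[OF cs, of vs] p that by auto
  have xq: "E x q" using q(3) E_commute by blast
  show pq: "\<not> E p q"
  proof
    assume "E p q"
    then have "E q p" using E_commute by blast
    then show False
      using outside[of "[p, a, q]"] outside[of "[p, a, b, q]"] outside[of "[p, a, b, c, q]"]
        outside[of "[p, a, d, q]"] E dist p pa q xq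
      by (auto simp: cycle_list_3 cycle_list_4 cycle_list_5)
  qed
  show "\<not> E y q" if y: "y \<notin> {a, b, c, d}" "E y p"
  proof
    assume "E y q"
    then have "E q y" "y \<noteq> q" "y \<noteq> p" using E_commute y by auto
    then show False
      using outside[of "[y, p, a, q]"] outside[of "[y, p, a, b, q]"] outside[of "[y, p, a, b, c, q]"]
        outside[of "[y, p, a, d, q]"] E dist p pa q xq y
      by (auto simp: cycle_list_4 cycle_list_5 cycle_list_6)
  qed
qed

text \<open>
  The three pairs are \<open>p\<close>, \<open>a\<close>; \<open>q\<close>, \<open>b\<close>; and the remaining edge \<open>c\<close>, \<open>d\<close> of the square.
\<close>

lemma square_no_adjacent_attached:
  assumes cs: "cycle_list [a, b, c, d]" and p: "p \<notin> {a, b, c, d}" "E p a"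
    and q: "q \<notin> {a, b, c, d}" "E q b"
  shows False
proof -
  have E: "E a b" "E b c" "E c d" "E d a" and dist: "distinct [a, b, c, d]"
    using cs unfolding cycle_list_4 by auto
  have S: "{b, c, d, a} = {a, b, c, d}" by blast
  have pq: "q \<noteq> p" using square_attached_once(1)[OF cs p] q by blast
  show False
    by (rule no_three_pairs[OF p(2) q(2) E(3)])
      (use dist p q pq square_attached_once[OF cs p]
        square_attached_once[OF square_rotate[OF cs], unfolded S, OF q]
        square_attached_paths(1)[OF cs p q(1) pq q(2)] in auto)
qed

text \<open>
  The nullity of a positive square is \<open>2\<close>, not \<open>0\<close>.
\<close>

lemma square_alone:
  assumes cs: "cycle_list [a, b, c, d]" and V: "verts G = {a, b, c, d}"
  shows "graph_iso G (cycle_graph 4) \<and> \<not> balanced G \<sigma>"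
proof -
  have E: "E a b" "E b c" "E c d" "E d a" and dist: "distinct [a, b, c, d]"
    using cs unfolding cycle_list_4 by auto
  note chords = square_chord[OF cs] square_chord[OF square_rotate[OF cs]]
  have ed: "edges G = cycle_edges [a, b, c, d]"
  proof (rule edges_eqI)
    fix u v
    show "E u v \<longleftrightarrow> {u, v} \<in> cycle_edges [a, b, c, d]"
    proof
      assume uv: "E u v"
      then have "u \<in> {a, b, c, d}" "v \<in> {a, b, c, d}" using E_verts V by auto
      then show "{u, v} \<in> cycle_edges [a, b, c, d]"
        unfolding cycle_edges_4 using uv chords
        by (elim insertE emptyE) (simp_all add: doubleton_eq_iff)
    next
      assume "{u, v} \<in> cycle_edges [a, b, c, d]"
      then show "E u v" using E by (auto simp: cycle_edges_4 E_def)
    qed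
  qed (auto simp: cycle_edges_4)
  then have "G = (set [a, b, c, d], cycle_edges [a, b, c, d])"
    using V by (simp add: prod_eq_iff)
  then have "\<exists>xs. length xs = 4 \<and> distinct xs \<and> G = (set xs, cycle_edges xs)"
    using dist by (intro exI[of _ "[a, b, c, d]"]) simp
  then have "graph_iso G (cycle_graph 4)"
    by (subst graph_iso_cycle_iff[OF simple]) simp_all
  moreover have "\<not> balanced G \<sigma>"
  proof
    assume "balanced G \<sigma>"
    then have "s a b * s b c * s c d * s d a = 1"
      using balanced_iff[OF cs] prod_square[OF cs] by simp
    then have "nullity G \<sigma> = 2" by (rule nullity_positive_square[OF V ed dist])
    then show False using nullity V dist by simp
  qed
  ultimately show ?thesis ..
qed

text \<open>
  If vertices are attached only at two opposite corners and none is farther away, then the edges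
  are determined, since attached vertices are not adjacent to each other.
\<close>

lemma square_no_far_vertex:
  assumes cs: "cycle_list [a, b, c, d]"
    and no: "\<And>p. p \<notin> {a, b, c, d} \<Longrightarrow> \<not> E p b" "\<And>p. p \<notin> {a, b, c, d} \<Longrightarrow> \<not> E p d"
    and near: "\<And>v. v \<in> verts G \<Longrightarrow> v \<in> {a, b, c, d} \<or> E v a \<or> E v c"
  shows "G = square_stars a b c d {p. p \<notin> {a, b, c, d} \<and> E p a} {p. p \<notin> {a, b, c, d} \<and> E p c}"
proof -
  let ?S = "{a, b, c, d}"
  define P Q where "P = {p. p \<notin> ?S \<and> E p a}" and "Q = {p. p \<notin> ?S \<and> E p c}"
  have E: "E a b" "E b c" "E c d" "E d a" and dist: "distinct [a, b, c, d]"
    using cs unfolding cycle_list_4 by auto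
  have SV: "?S \<subseteq> verts G" using cycle_list_verts[OF cs] by simp
  have PV: "P \<subseteq> verts G" "Q \<subseteq> verts G" using E_verts by (auto simp: P_def Q_def)
  have V: "verts G = ?S \<union> P \<union> Q"
    using SV PV near by (auto simp: P_def Q_def)
  have S: "{c, d, a, b} = ?S" by blast
  note cs2 = square_rotate[OF square_rotate[OF cs]]
  have indep: "\<not> E u v" if "u \<in> P \<union> Q" "v \<in> P \<union> Q" for u v
  proof (cases "v = u")
    case False
    then show ?thesis
      using that square_attached_paths(1)[OF cs, of u v] square_attached_paths(1)[OF cs2, unfolded S, of u v]
      by (auto simp: P_def Q_def)
  qed simp
  note chords = square_chord[OF cs] square_chord[OF square_rotate[OF cs]]
  have out: "u = a \<and> v \<in> P \<or> u = c \<and> v \<in> Q" if "u \<in> ?S" "v \<notin> ?S" "E v u" for u v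
    using that no[of v] by (auto simp: P_def Q_def)
  have "edges G = cycle_edges [a, b, c, d] \<union> star_edges a P \<union> star_edges c Q"
  proof (rule edges_eqI)
    fix u v
    show "E u v \<longleftrightarrow> {u, v} \<in> cycle_edges [a, b, c, d] \<union> star_edges a P \<union> star_edges c Q" (is "_ \<longleftrightarrow> ?R")
    proof
      assume uv: "E u v"
      then have vu: "E v u" using E_commute by blast
      consider "u \<in> ?S" "v \<in> ?S" | "u \<in> ?S" "v \<notin> ?S" | "u \<notin> ?S" "v \<in> ?S" | "u \<notin> ?S" "v \<notin> ?S" by blast
      then show ?R
      proof cases
        case 1
        then have "{u, v} \<in> cycle_edges [a, b, c, d]"
          unfolding cycle_edges_4 using uv chords
          by (elim insertE emptyE) (simp_all add: doubleton_eq_iff)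
        then show ?thesis by blast
      next
        case 2
        show ?thesis using out[OF 2 vu] by (simp add: in_star_edges) blast
      next
        case 3
        show ?thesis using out[OF 3(2,1) uv] by (simp add: in_star_edges) blast
      next
        case 4
        then show ?thesis using uv indep[of u v] E_verts[OF uv] V by blast
      qed
    next
      assume ?R
      then consider "{u, v} \<in> cycle_edges [a, b, c, d]" | "{u, v} \<in> star_edges a P" | "{u, v} \<in> star_edges c Q"
        by blast
      then show "E u v"
      proof cases
        case 1
        then show ?thesis using E by (auto simp: cycle_edges_4 E_def)
      qed (use E_commute[of u v] in \<open>auto simp: in_star_edges P_def Q_def\<close>)
    qed
  next
    show "\<exists>u v. e = {u, v}" if "e \<in> cycle_edges [a, b, c, d] \<union> star_edges a P \<union> star_edges c Q" for e
      using that by (auto simp: cycle_edges_4 star_edges_def)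
  qed
  then have "G = square_stars a b c d P Q" using V by (simp add: prod_eq_iff square_stars_def)
  then show ?thesis by (simp add: P_def Q_def)
qed

text \<open>
  A vertex \<open>y\<close> at distance two from the square forms with its neighbour \<open>p\<close> a pair that can be
  split off. So the square is singular, hence positive. A second attached vertex \<open>q\<close> would lead to
  three pairs, and so would a vertex at distance three from the square. Thus everything outside
  the square is a star with centre \<open>p\<close>.
\<close>

lemma square_far_vertex:
  assumes cs: "cycle_list [a, b, c, d]" and p: "p \<notin> {a, b, c, d}" "E p a"
    and y: "y \<notin> {a, b, c, d}" "E y p" "\<And>x. x \<in> {a, b, c, d} \<Longrightarrow> \<not> E y x"
  shows "\<exists>r\<ge>1. graph_iso G (U3 r) \<and> balanced G \<sigma>"
proof -
  let ?S = "{a, b, c, d}"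
  have E: "E a b" "E b c" "E c d" "E d a" and dist: "distinct [a, b, c, d]"
    using cs unfolding cycle_list_4 by auto
  have SV: "?S \<subseteq> verts G" using cycle_list_verts[OF cs] by simp
  note chords = square_chord[OF cs] square_chord[OF square_rotate[OF cs]]
  have sg: "s a b \<in> {1, -1}" "s b c \<in> {1, -1}" "s c d \<in> {1, -1}" "s d a \<in> {1, -1}"
    by (intro s_sign E)+
  have yp: "y \<noteq> p" using y(2) by auto
  note once = square_attached_once[OF cs p]
  have pos: "s a b * s b c * s c d * s d a = 1"
  proof (rule ccontr)
    assume "\<not> ?thesis"
    then have "s a b * s b c * s c d * s d a = -1" using sg by auto
    then have "nonsingular_on s ?S"
      by (intro nonsingular_on_negative_square[OF E dist]) (use chords in auto)
    then have "nonsingular_on s (insert y (insert p ?S))"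
      by (rule nonsingular_on_insert_pair) (use p y yp in auto)
    then have "card (insert y (insert p ?S)) \<le> 4"
      by (rule nonsingular_card_le[rotated]) (use SV E_verts[OF y(2)] in simp)
    then show False using p(1) y(1) yp dist by simp
  qed
  have bal: "balanced G \<sigma>" using pos balanced_iff[OF cs] prod_square[OF cs] by simp
  have attached: "q = p" if q: "q \<notin> ?S" "E q x" "x \<in> ?S" for q x
  proof (rule ccontr)
    assume qp: "q \<noteq> p"
    note path = square_attached_paths[OF cs p q(1) qp q(2,3)]
    have yq: "y \<noteq> q" using y(3) q by blast
    from q(3) consider "x = a" | "x = b" | "x = c" | "x = d" by blast
    then show False
    proof cases
      case 1
      show False
        by (rule no_three_pairs[OF y(2) q(2) E(2)])
          (use 1 path(2)[OF y(1,2)] y p q qp yp yq dist square_attached_once[OF cs, of q] in auto)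
    next
      case 2
      then show False using square_no_adjacent_attached[OF cs p q(1)] q(2) by blast
    next
      case 3
      have S: "{c, d, a, b} = ?S" by blast
      show False
        by (rule no_three_pairs[OF y(2) q(2) E(1)])
          (use 3 path(2)[OF y(1,2)] y p q qp yp yq dist
            square_attached_once[OF square_rotate[OF square_rotate[OF cs]], unfolded S, of q] in auto)
    next
      case 4
      have S: "{a, d, c, b} = ?S" by blast
      show False using square_no_adjacent_attached[OF square_reflect[OF cs], unfolded S, OF p q(1)] q(2) 4 by blast
    qed
  qed
  define P where "P = {z. z \<noteq> a \<and> E z p}"
  have PS: "z \<notin> ?S" "z \<noteq> p" if "z \<in> P" for z
    using that once E_commute[of z p] by (auto simp: P_def)
  have far: False if u: "u \<in> P" and uv: "E u v" and v: "v \<notin> ?S" "v \<noteq> p" "v \<notin> P" for u v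
  proof -
    have up: "E u p" using u by (simp add: P_def)
    have vu: "E v u" using uv E_commute by blast
    have "\<not> E v x" "\<not> E u x" if "x \<in> ?S" for x
      using attached[of v x] attached[of u x] v PS[OF u] that by blast+
    moreover have "\<not> E v p" using v by (auto simp: P_def)
    moreover have "v \<noteq> u" using uv by auto
    ultimately show False
      by (intro no_three_pairs[OF vu p(2) E(2)]) (use once v PS[OF u] p dist in auto)
  qed
  have PV: "P \<subseteq> verts G" using E_verts by (auto simp: P_def)
  have pa: "E a p" using p(2) E_commute by blast
  have out: "u = a \<and> v = p" if "u \<in> ?S" "v \<notin> ?S" "E u v" for u v
  proof -
    have "E v u" using that E_commute by blast
    then have "v = p" using attached that by blast
    then show ?thesis using that once E_commute[of u v] by auto
  qed
  have "verts G \<subseteq> ?S \<union> {p} \<union> P"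
  proof (rule verts_subset_of_closed[of a])
    fix u v assume u: "u \<in> ?S \<union> {p} \<union> P" and uv: "E u v"
    consider "u \<in> ?S" | "u = p" | "u \<in> P" using u by blast
    then show "v \<in> ?S \<union> {p} \<union> P"
    proof cases
      case 1
      then show ?thesis using out[of u v] uv by blast
    next
      case 2
      then show ?thesis using uv E_commute[of u v] by (auto simp: P_def)
    next
      case 3
      then show ?thesis using far[OF 3 uv] by blast
    qed
  qed (use SV in auto)
  then have V: "verts G = ?S \<union> {p} \<union> P" using SV PV E_verts[OF p(2)] by blast
  have indep: "\<not> E u v" if u: "u \<in> P" and v: "v \<in> P" for u v
  proof
    assume uv: "E u v"
    have "E u p" "E v p" "E p u" using u v E_commute by (auto simp: P_def)
    then have "cycle_list [u, v, p]" using uv PS[OF u] PS[OF v] by (auto simp: cycle_list_3)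
    then show False using cycle_list_unique(1)[OF cs, of "[u, v, p]"] p(1) by auto
  qed
  have "edges G = cycle_edges [a, b, c, d] \<union> star_edges p (insert a P)"
  proof (rule edges_eqI)
    fix u v
    show "E u v \<longleftrightarrow> {u, v} \<in> cycle_edges [a, b, c, d] \<union> star_edges p (insert a P)" (is "_ \<longleftrightarrow> ?R")
    proof
      assume uv: "E u v"
      then have vu: "E v u" using E_commute by blast
      have uvV: "u \<in> ?S \<union> {p} \<union> P" "v \<in> ?S \<union> {p} \<union> P" using E_verts[OF uv] V by blast+
      consider "u \<in> ?S" "v \<in> ?S" | "u \<in> ?S" "v \<notin> ?S" | "u \<notin> ?S" "v \<in> ?S" | "u \<notin> ?S" "v \<notin> ?S" by blast
      then show ?R
      proof cases
        case 1
        then have "{u, v} \<in> cycle_edges [a, b, c, d]"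
          unfolding cycle_edges_4 using uv chords
          by (elim insertE emptyE) (simp_all add: doubleton_eq_iff)
        then show ?thesis by blast
      next
        case 2
        show ?thesis using out[OF 2 uv] by (simp add: in_star_edges)
      next
        case 3
        show ?thesis using out[OF 3(2,1) vu] by (simp add: in_star_edges)
      next
        case 4
        then have "u = p \<and> v \<in> P \<or> v = p \<and> u \<in> P"
          using uvV indep[of u v] uv by auto
        then show ?thesis by (auto simp: in_star_edges)
      qed
    next
      assume ?R
      then consider "{u, v} \<in> cycle_edges [a, b, c, d]" | "{u, v} \<in> star_edges p (insert a P)"
        by blast
      then show "E u v"
      proof cases
        case 1
        then show ?thesis using E by (auto simp: cycle_edges_4 E_def)
      next
        case 2
        then show ?thesis using p(2) pa E_commute[of u v] by (auto simp: in_star_edges P_def)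
      qed
    qed
  next
    show "\<exists>u v. e = {u, v}" if "e \<in> cycle_edges [a, b, c, d] \<union> star_edges p (insert a P)" for e
      using that by (auto simp: cycle_edges_4 star_edges_def)
  qed
  then have "G = square_hung_star a b c d p P" using V by (auto simp: prod_eq_iff square_hung_star_def)
  moreover have finP: "finite P" using PV finite_verts finite_subset by blast
  ultimately have "graph_iso G (U3 (card P))"
    unfolding graph_iso_U3_iff[OF simple]
    by (intro exI[of _ a] exI[of _ b] exI[of _ c] exI[of _ d] exI[of _ p] exI[of _ P])
      (use dist p PS in auto)
  moreover have "y \<in> P" using y by (auto simp: P_def)
  then have "card P \<ge> 1" using finP by (metis One_nat_def Suc_leI card_gt_0_iff empty_iff)
  ultimately show ?thesis using bal by blast
qed

lemma square_attached_case:
  assumes cs: "cycle_list [a, b, c, d]" and p: "p \<notin> {a, b, c, d}" "E p a"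
  shows "(\<exists>r s. r \<ge> s \<and> r + s \<ge> 1 \<and> graph_iso G (U2 r s)) \<or> (\<exists>r\<ge>1. graph_iso G (U3 r) \<and> balanced G \<sigma>)"
proof -
  let ?S = "{a, b, c, d}"
  have dist: "distinct [a, b, c, d]" using cs by (simp add: cycle_list_def)
  have S: "{a, d, c, b} = ?S" "{c, d, a, b} = ?S" by blast+
  note cs2 = square_rotate[OF square_rotate[OF cs]]
  note reflect = square_reflect[OF cs]
  have SV: "?S \<subseteq> verts G" using cycle_list_verts[OF cs] by simp
  have no: "\<not> E q b" "\<not> E q d" if "q \<notin> ?S" for q
    using square_no_adjacent_attached[OF cs p that]
      square_no_adjacent_attached[OF reflect, unfolded S, OF p that] by blast+
  show ?thesis
  proof (cases "\<forall>v\<in>verts G. v \<in> ?S \<or> E v a \<or> E v c")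
    case True
    define P Q where "P = {p. p \<notin> ?S \<and> E p a}" and "Q = {p. p \<notin> ?S \<and> E p c}"
    have PQ: "finite P" "finite Q" "?S \<inter> P = {}" "?S \<inter> Q = {}" "P \<inter> Q = {}"
      using finite_subset[OF _ finite_verts] E_verts square_attached_once[OF cs]
      by (auto simp: P_def Q_def intro: finite_subset[OF _ finite_verts])
    have G: "G = square_stars a b c d P Q"
      using square_no_far_vertex[OF cs no] True by (simp add: P_def Q_def)
    have G': "G = square_stars c d a b Q P"
      using square_no_far_vertex[OF cs2, unfolded S, OF no(2,1)] True by (auto simp: P_def Q_def)
    have "p \<in> P" using p by (simp add: P_def)
    then have ge1: "card P \<ge> 1" using PQ(1) by (metis One_nat_def Suc_leI card_gt_0_iff empty_iff)
    have "graph_iso G (U2 (card P) (card Q))"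
      unfolding graph_iso_U2_iff[OF simple]
      by (rule exI[of _ a], rule exI[of _ b], rule exI[of _ c], rule exI[of _ d], rule exI[of _ P], rule exI[of _ Q])
        (use G PQ dist in blast)
    moreover have "graph_iso G (U2 (card Q) (card P))"
      unfolding graph_iso_U2_iff[OF simple]
      by (rule exI[of _ c], rule exI[of _ d], rule exI[of _ a], rule exI[of _ b], rule exI[of _ Q], rule exI[of _ P])
        (use G' PQ dist in auto)
    ultimately show ?thesis
      using ge1 by (metis le_add1 le_add2 le_trans linear)
  next
    case False
    define T where "T = ?S \<union> {v. E v a \<or> E v c}"
    have "\<not> verts G \<subseteq> T" using False by (auto simp: T_def)
    then obtain u y where uy: "u \<in> T" "E u y" "y \<notin> T"
      using verts_subset_of_closed[of a T] SV by (auto simp: T_def)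
    have yx: "\<not> E y x" if "x \<in> ?S" for x
      using uy(3) no[of y] that by (auto simp: T_def)
    have yS: "y \<notin> ?S" using uy(3) by (simp add: T_def)
    have yu: "E y u" using uy(2) E_commute by blast
    have uS: "u \<notin> ?S" using yx yu by blast
    then consider "E u a" | "E u c" using uy(1) by (auto simp: T_def)
    then have "\<exists>r\<ge>1. graph_iso G (U3 r) \<and> balanced G \<sigma>"
    proof cases
      case 1
      show ?thesis by (rule square_far_vertex[OF cs uS 1 yS yu yx])
    next
      case 2
      show ?thesis by (rule square_far_vertex[OF cs2, unfolded S, OF uS 2 yS yu yx])
    qed
    then show ?thesis ..
  qed
qed

lemma square_case:
  assumes cs: "cycle_list [a, b, c, d]"
  shows "(graph_iso G (cycle_graph 4) \<and> \<not> balanced G \<sigma>) \<or>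
    (\<exists>r s. r \<ge> s \<and> r + s \<ge> 1 \<and> graph_iso G (U2 r s)) \<or> (\<exists>r\<ge>1. graph_iso G (U3 r) \<and> balanced G \<sigma>)"
proof (cases "verts G \<subseteq> {a, b, c, d}")
  case True
  then have "verts G = {a, b, c, d}" using cycle_list_verts[OF cs] by auto
  then show ?thesis using square_alone[OF cs] by blast
next
  case False
  have S: "{b, c, d, a} = {a, b, c, d}" "{c, d, a, b} = {a, b, c, d}" "{d, a, b, c} = {a, b, c, d}" by blast+
  note r1 = square_rotate[OF cs] note r2 = square_rotate[OF r1] note r3 = square_rotate[OF r2]
  obtain u p where up: "u \<in> {a, b, c, d}" "E u p" "p \<notin> {a, b, c, d}"
    using False verts_subset_of_closed[of a "{a, b, c, d}"] cycle_list_verts[OF cs] by auto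
  then have pu: "E p u" using E_commute by blast
  from up(1) consider "u = a" | "u = b" | "u = c" | "u = d" by blast
  then show ?thesis
    using square_attached_case[OF cs up(3)] square_attached_case[OF r1, unfolded S, OF up(3)]
      square_attached_case[OF r2, unfolded S, OF up(3)] square_attached_case[OF r3, unfolded S, OF up(3)] pu
    by cases blast+
qed

section \<open>The classification\<close>

lemma classification:
  "(graph_iso G (cycle_graph 4) \<and> \<not> balanced G \<sigma>) \<or>
   (graph_iso G (cycle_graph 6) \<and> \<not> balanced G \<sigma>) \<or>
   (\<exists>r s. r \<ge> s \<and> r + s \<ge> 1 \<and> (graph_iso G (U1 r s) \<or> graph_iso G (U2 r s))) \<or>
   (\<exists>r\<ge>1. graph_iso G (U3 r) \<and> balanced G \<sigma>)"
proof -
  obtain cs where cs: "cycle_list cs" using ex_cyc by blast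
  have "length cs \<ge> 3" using cs by (simp add: cycle_list_def)
  then consider "length cs = 3" | "length cs = 4" | "length cs = 6"
    using cycle_list_length_le[OF cs] cycle_list_length_neq_5[OF cs] by linarith
  then show ?thesis
  proof cases
    case 1
    then obtain a b c where "cs = [a, b, c]" unfolding length_3 by blast
    then show ?thesis using triangle_case[of a b c] cs by blast
  next
    case 2
    then obtain a b c d where "cs = [a, b, c, d]" unfolding length_4 by blast
    then show ?thesis using square_case[of a b c d] cs by blast
  next
    case 3
    then obtain a b c d e f where "cs = [a, b, c, d, e, f]" unfolding length_6 by blast
    then show ?thesis using hexagon_case[of a b c d e f] cs by blast
  qed
qed

end

context unicyclic_signed
begin

lemma cycle_list_sign:
  assumes "cycle_list cs" shows "(\<Prod>e\<in>cycle_edges cs. \<sigma> e) \<in> {1, -1}"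
proof -
  have "(\<Prod>e\<in>C. \<sigma> e) \<in> {1, -1}" if "finite C" "C \<subseteq> edges G" for C
    using that by (induction C) (use signed in \<open>auto simp: signed_graph_def\<close>)
  moreover have "finite (cycle_edges cs)" by (simp add: cycle_edges_image)
  ultimately show ?thesis using assms by (simp add: cycle_list_def)
qed

lemma nullity_of_classified:
  assumes "(graph_iso G (cycle_graph 4) \<and> \<not> balanced G \<sigma>) \<or>
   (graph_iso G (cycle_graph 6) \<and> \<not> balanced G \<sigma>) \<or>
   (\<exists>r s. r \<ge> s \<and> r + s \<ge> 1 \<and> (graph_iso G (U1 r s) \<or> graph_iso G (U2 r s))) \<or>
   (\<exists>r\<ge>1. graph_iso G (U3 r) \<and> balanced G \<sigma>)"
  shows "nullity G \<sigma> = card (verts G) - 4"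
proof -
  consider (C4) "graph_iso G (cycle_graph 4)" "\<not> balanced G \<sigma>"
    | (C6) "graph_iso G (cycle_graph 6)" "\<not> balanced G \<sigma>"
    | (U1) r t where "r \<ge> t" "r + t \<ge> 1" "graph_iso G (U1 r t)"
    | (U2) r t where "r \<ge> t" "r + t \<ge> 1" "graph_iso G (U2 r t)"
    | (U3) r where "r \<ge> 1" "graph_iso G (U3 r)" "balanced G \<sigma>"
    using assms by blast
  then show ?thesis
  proof cases
    case C4
    then obtain xs where xs: "length xs = 4" "distinct xs" "G = (set xs, cycle_edges xs)"
      using graph_iso_cycle_iff[OF simple, of 4] by auto
    then obtain a b c d where abcd: "xs = [a, b, c, d]" unfolding length_4 by blast
    have V: "verts G = {a, b, c, d}" "edges G = cycle_edges [a, b, c, d]" "distinct [a, b, c, d]"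
      using xs abcd by simp_all
    then have cs: "cycle_list [a, b, c, d]" unfolding cycle_list_def by simp
    show ?thesis
      by (rule nullity_negative_square[OF V])
        (use C4 balanced_iff[OF cs] cycle_list_sign[OF cs] prod_square[OF cs] in auto)
  next
    case C6
    then obtain xs where xs: "length xs = 6" "distinct xs" "G = (set xs, cycle_edges xs)"
      using graph_iso_cycle_iff[OF simple, of 6] by auto
    then obtain a b c d e f where abcdef: "xs = [a, b, c, d, e, f]" unfolding length_6 by blast
    have V: "verts G = {a, b, c, d, e, f}" "edges G = cycle_edges [a, b, c, d, e, f]"
      "distinct [a, b, c, d, e, f]"
      using xs abcdef by simp_all
    then have cs: "cycle_list [a, b, c, d, e, f]" unfolding cycle_list_def by simp
    show ?thesis
      by (rule nullity_negative_hexagon[OF V])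
        (use C6 balanced_iff[OF cs] cycle_list_sign[OF cs] prod_hexagon[OF cs] in auto)
  next
    case U1
    then obtain a b c P Q where *: "distinct [a, b, c]" "finite P" "{a, b, c} \<inter> P = {}"
      "{a, b, c} \<inter> Q = {}" "P \<inter> Q = {}" "card P = r" "G = triangle_stars a b c P Q"
      unfolding graph_iso_U1_iff[OF simple] by blast
    have "card P > 0" using U1 *(6) by linarith
    then obtain p where "p \<in> P" by (metis card_gt_0_iff ex_in_conv)
    then show ?thesis by (rule nullity_triangle_stars[OF *(7,1,3,4,5)])
  next
    case U2
    then obtain a b c d P Q where *: "distinct [a, b, c, d]" "finite P" "{a, b, c, d} \<inter> P = {}"
      "{a, b, c, d} \<inter> Q = {}" "P \<inter> Q = {}" "card P = r" "G = square_stars a b c d P Q"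
      unfolding graph_iso_U2_iff[OF simple] by blast
    have "card P > 0" using U2 *(6) by linarith
    then obtain p where "p \<in> P" by (metis card_gt_0_iff ex_in_conv)
    then show ?thesis by (rule nullity_square_stars[OF *(7,1,3,4,5)])
  next
    case U3
    then obtain a b c d e P where *: "distinct [a, b, c, d, e]" "finite P" "{a, b, c, d, e} \<inter> P = {}"
      "card P = r" "G = square_hung_star a b c d e P"
      unfolding graph_iso_U3_iff[OF simple] by blast
    have "card P > 0" using U3 *(4) by linarith
    then obtain p where p: "p \<in> P" by (metis card_gt_0_iff ex_in_conv)
    have "edges G = cycle_edges [a, b, c, d] \<union> star_edges e (insert a P)"
      by (subst *(5)) (simp add: square_hung_star_def)
    then have cs: "cycle_list [a, b, c, d]" unfolding cycle_list_def using *(1) by simp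
    then have "s a b * s b c * s c d * s d a = 1"
      using U3(3) balanced_iff prod_square by metis
    then show ?thesis by (rule nullity_square_hung_star[OF *(5,1,3) p])
  qed
qed

end

theorem theorem3p3:
  fixes G :: "'a ugraph" and \<sigma> :: "'a set \<Rightarrow> real" and n :: nat
  assumes "signed_graph G \<sigma>"
    and "unicyclic G"
    and "card (verts G) = n"
    and "n \<ge> 4"
  shows "nullity G \<sigma> = n - 4 \<longleftrightarrow>
     (graph_iso G (cycle_graph 4) \<and> \<not> balanced G \<sigma>) \<or>
     (graph_iso G (cycle_graph 6) \<and> \<not> balanced G \<sigma>) \<or>
     (\<exists>r s. r \<ge> s \<and> r + s \<ge> 1 \<and> (graph_iso G (U1 r s) \<or> graph_iso G (U2 r s))) \<or>
     (\<exists>r\<ge>1. graph_iso G (U3 r) \<and> balanced G \<sigma>)"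
proof
  interpret unicyclic_signed G \<sigma> by unfold_locales (use assms in auto)
  show "nullity G \<sigma> = n - 4" if "(graph_iso G (cycle_graph 4) \<and> \<not> balanced G \<sigma>) \<or>
     (graph_iso G (cycle_graph 6) \<and> \<not> balanced G \<sigma>) \<or>
     (\<exists>r s. r \<ge> s \<and> r + s \<ge> 1 \<and> (graph_iso G (U1 r s) \<or> graph_iso G (U2 r s))) \<or>
     (\<exists>r\<ge>1. graph_iso G (U3 r) \<and> balanced G \<sigma>)"
    using nullity_of_classified[OF that] assms(3) by simp
next
  assume "nullity G \<sigma> = n - 4"
  then interpret unicyclic_rank_four G \<sigma> by unfold_locales (use assms in auto)
  show "(graph_iso G (cycle_graph 4) \<and> \<not> balanced G \<sigma>) \<or>
     (graph_iso G (cycle_graph 6) \<and> \<not> balanced G \<sigma>) \<or>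
     (\<exists>r s. r \<ge> s \<and> r + s \<ge> 1 \<and> (graph_iso G (U1 r s) \<or> graph_iso G (U2 r s))) \<or>
     (\<exists>r\<ge>1. graph_iso G (U3 r) \<and> balanced G \<sigma>)"
    by (rule classification)
qed

end
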